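(* Let $h : \mathbb{N} \to \mathbb{C}$ be a completely multiplicative function satisfying $|h(p)| \le 1$ for every prime $p$. Let $q$ be a positive integer and let $x,y$ be real numbers with $2 \le y \le x$, $2 \le x \le q$ and $(\log x)^6 \le y \le x^{\frac{1}{32\log\log x}}$. Then $$\frac{1}{\varphi(q)} \sum_{\chi \bmod q} \Bigl| \sum_{\substack{n \le x \\ P(n) \le y}} h(n)\chi(n) \Bigr| \ll \sqrt{\Psi(x,y)\, S(x,y,q)},$$ with an absolute implied constant, where, with $u = \frac{\log x}{\log y}$ and $\alpha(x,y)$ the saddle point, $$S(x,y,q) := (\log x)^{3/2} (\log y)^{1/2} \left( y^{1/2-\alpha(x,y)} + \exp\left\{ -\frac{u}{4}\left( \frac{\log \min\{q, x^{3/2}\}}{\log x} - 1 \right)^2 \right\} \right).$$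
   Context: $P(n)$ denotes the largest prime factor of the positive integer $n$, with $n=1$ counted as satisfying $P(n)\le y$; thus $P(n) \le y$ means that all prime factors of $n$ are at most $y$. $\Psi(x,y) = \#\{ n \le x : P(n) \le y\}$. The sum $\sum_{\chi \bmod q}$ runs over all $\varphi(q)$ Dirichlet characters modulo $q$, where $\varphi$ is Euler's totient function. For $2 \le y \le x$, the saddle point $\alpha(x,y)$ is the unique real (positive) solution $\alpha$ of $$\sum_{p \le y} \frac{\log p}{p^{\alpha} - 1} = \log x,$$ the sum being over primes $p \le y$. Completely multiplicative means $h(1)=1$ and $h(mn)=h(m)h(n)$ for all positive integers $m,n$. $A \ll B$ means $|A| \le C B$ for some constant $C>0$. *)

theory Defs
  imports Complex_Main "HOL-Number_Theory.Number_Theory"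
begin

definition completely_multiplicative :: "(nat \<Rightarrow> complex) \<Rightarrow> bool" where
  "completely_multiplicative h \<longleftrightarrow>
     h 1 = 1 \<and> (\<forall>m>0. \<forall>n>0. h (m * n) = h m * h n)"

text \<open>Periodicity makes it harmless that characters are also defined at \<open>0\<close>.\<close>

definition dirichlet_char :: "nat \<Rightarrow> (nat \<Rightarrow> complex) \<Rightarrow> bool" where
  "dirichlet_char q \<chi> \<longleftrightarrow>
     \<chi> 1 = 1 \<and> (\<forall>m n. \<chi> (m * n) = \<chi> m * \<chi> n) \<and>
     (\<forall>n. \<chi> (n + q) = \<chi> n) \<and> (\<forall>n. \<chi> n \<noteq> 0 \<longleftrightarrow> coprime n q)"

definition dirichlet_chars :: "nat \<Rightarrow> (nat \<Rightarrow> complex) set" where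
  "dirichlet_chars q = {\<chi>. dirichlet_char q \<chi>}"

text \<open>The largest prime factor of a positive integer, with value \<open>1\<close> at \<open>1\<close>, so that \<open>1\<close> is
  \<open>y\<close>-smooth for every \<open>y \<ge> 1\<close>.\<close>

definition largest_prime_factor :: "nat \<Rightarrow> nat" where
  "largest_prime_factor n = Max (insert 1 (prime_factors n))"

definition smooth_upto :: "real \<Rightarrow> real \<Rightarrow> nat set" where
  "smooth_upto x y = {n. 0 < n \<and> real n \<le> x \<and> real (largest_prime_factor n) \<le> y}"

definition smooth_count :: "real \<Rightarrow> real \<Rightarrow> nat" where
  "smooth_count x y = card (smooth_upto x y)"

definition saddle_point :: "real \<Rightarrow> real \<Rightarrow> real" where
  "saddle_point x y =
     (THE \<alpha>. 0 < \<alpha> \<and> (\<Sum>p | prime p \<and> real p \<le> y. ln (real p) / (real p powr \<alpha> - 1)) = ln x)"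

definition char_bound :: "real \<Rightarrow> real \<Rightarrow> nat \<Rightarrow> real" where
  "char_bound x y q =
     (let u = ln x / ln y in
      (ln x) powr (3/2) * (ln y) powr (1/2) *
        (y powr (1/2 - saddle_point x y) +
         exp (- (u / 4) * (ln (min (real q) (x powr (3/2))) / ln x - 1)\<^sup>2)))"

lemma largest_prime_factor_le_iff:
  assumes "1 \<le> y"
  shows "real (largest_prime_factor n) \<le> y \<longleftrightarrow> (\<forall>p. prime p \<and> p dvd n \<and> n > 0 \<longrightarrow> real p \<le> y)"
proof -
  have "real (largest_prime_factor n) \<le> y \<longleftrightarrow> largest_prime_factor n \<le> nat \<lfloor>y\<rfloor>"
    using assms by (simp add: le_nat_iff le_floor_iff)
  also have "\<dots> \<longleftrightarrow> (\<forall>p\<in>prime_factors n. p \<le> nat \<lfloor>y\<rfloor>)"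
  proof -
    have "1 \<le> nat \<lfloor>y\<rfloor>" using assms by (simp add: le_nat_iff le_floor_iff)
    thus ?thesis unfolding largest_prime_factor_def by (subst Max_le_iff) auto
  qed
  also have "\<dots> \<longleftrightarrow> (\<forall>p\<in>prime_factors n. real p \<le> y)"
    using assms by (simp add: le_nat_iff le_floor_iff)
  also have "\<dots> \<longleftrightarrow> (\<forall>p. prime p \<and> p dvd n \<and> n > 0 \<longrightarrow> real p \<le> y)"
    by (cases "n = 0") (auto simp: prime_factors_dvd)
  finally show ?thesis .
qed

lemma finite_smooth_upto: "finite (smooth_upto x y)"
proof (rule finite_subset)
  show "smooth_upto x y \<subseteq> {..nat \<lfloor>x\<rfloor>}"
    by (auto simp: smooth_upto_def le_nat_iff le_floor_iff)
qed simp

lemma dirichlet_char_mod: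
  assumes "dirichlet_char q \<chi>"
  shows "\<chi> (n mod q) = \<chi> n"
proof -
  have "\<chi> (m + k * q) = \<chi> m" for m k
  proof (induction k)
    case (Suc k)
    have "\<chi> (m + Suc k * q) = \<chi> ((m + k * q) + q)" by (simp add: algebra_simps)
    also have "\<dots> = \<chi> (m + k * q)" using assms unfolding dirichlet_char_def by blast
    finally show ?case using Suc by simp
  qed simp
  from this[of "n mod q" "n div q"] show ?thesis by simp
qed

lemma finite_dirichlet_chars:
  assumes "0 < q"
  shows "finite (dirichlet_chars q)"
proof -
  let ?R = "insert 0 {z :: complex. z ^ totient q = 1}"
  let ?F = "\<lambda>\<chi> :: nat \<Rightarrow> complex. restrict \<chi> {..<q}"
  have val: "\<chi> n \<in> ?R" if "dirichlet_char q \<chi>" for \<chi> n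
  proof (cases "coprime n q")
    case True
    have pow: "\<chi> (n ^ k) = \<chi> n ^ k" for k
      using that by (induction k) (simp_all add: dirichlet_char_def)
    have "n ^ totient q mod q = 1 mod q"
      using euler_theorem[OF True] by (simp add: cong_def)
    hence "\<chi> (n ^ totient q) = \<chi> 1"
      using dirichlet_char_mod[OF that] by metis
    thus ?thesis using that by (simp add: pow dirichlet_char_def)
  next
    case False
    hence "\<chi> n = 0" using that unfolding dirichlet_char_def by blast
    thus ?thesis by simp
  qed
  have "finite ?R"
    using assms finite_roots_unity[of "totient q"] by (simp add: Suc_le_eq)
  hence "finite (PiE {..<q} (\<lambda>_. ?R))" by (intro finite_PiE) auto
  moreover have "?F ` dirichlet_chars q \<subseteq> PiE {..<q} (\<lambda>_. ?R)"
  proof (rule image_subsetI)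
    fix \<chi> assume "\<chi> \<in> dirichlet_chars q"
    hence "\<chi> n \<in> ?R" for n using val by (simp only: dirichlet_chars_def mem_Collect_eq)
    thus "?F \<chi> \<in> PiE {..<q} (\<lambda>_. ?R)" by (simp only: PiE_iff restrict_apply extensional_restrict) simp
  qed
  ultimately have "finite (?F ` dirichlet_chars q)" by (rule rev_finite_subset)
  moreover have "inj_on ?F (dirichlet_chars q)"
  proof (rule inj_onI, rule ext)
    fix \<chi> \<chi>' n
    assume ch: "\<chi> \<in> dirichlet_chars q" "\<chi>' \<in> dirichlet_chars q" and eq: "?F \<chi> = ?F \<chi>'"
    have "n mod q < q" using assms by simp
    hence "\<chi> (n mod q) = \<chi>' (n mod q)" using eq by (metis lessThan_iff restrict_apply')
    thus "\<chi> n = \<chi>' n"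
      using ch dirichlet_char_mod unfolding dirichlet_chars_def by (metis mem_Collect_eq)
  qed
  ultimately show ?thesis by (rule finite_imageD)
qed

lemma saddle_point_ex1:
  assumes "2 \<le> y" "1 < x"
  shows "\<exists>!\<alpha>. 0 < \<alpha> \<and> (\<Sum>p | prime p \<and> real p \<le> y. ln (real p) / (real p powr \<alpha> - 1)) = ln x"
proof -
  define A where "A = {p :: nat. prime p \<and> real p \<le> y}"
  define F where "F = (\<lambda>\<alpha>. \<Sum>p\<in>A. ln (real p) / (real p powr \<alpha> - 1))"
  have finA: "finite A"
    by (rule finite_subset[of _ "{..nat \<lfloor>y\<rfloor>}"]) (auto simp: A_def le_nat_iff le_floor_iff)
  have two: "2 \<in> A" using assms by (simp add: A_def two_is_prime_nat)
  have gt1: "1 < real p" if "p \<in> A" for p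
    using that prime_gt_1_nat by (auto simp: A_def)
  have pow: "1 < real p powr a" if "p \<in> A" "0 < a" for p a
    using gt1[OF that(1)] that(2) by simp
  have anti: "F b < F a" if "0 < a" "a < b" for a b
    unfolding F_def
  proof (rule sum_strict_mono)
    fix p assume p: "p \<in> A"
    have "real p powr a < real p powr b" using gt1[OF p] that by simp
    thus "ln (real p) / (real p powr b - 1) < ln (real p) / (real p powr a - 1)"
      using pow[OF p, of a] pow[OF p, of b] that gt1[OF p]
      by (intro divide_strict_left_mono mult_pos_pos) auto
  qed (use finA two in auto)
  have lnx: "0 < ln x" using assms by simp
  define a where "a = log 2 (1 + ln 2 / ln x)"
  have "0 < ln 2 / ln x" using lnx by simp
  hence a: "0 < a" "2 powr a = 1 + ln 2 / ln x"
    unfolding a_def by (simp, intro powr_log_cancel) auto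
  have "ln x = ln (real 2) / (real 2 powr a - 1)" using a lnx by simp
  also have "\<dots> \<le> F a"
    unfolding F_def
    by (rule member_le_sum[OF two _ finA])
       (use pow[OF _ a(1)] gt1 in \<open>force intro!: divide_nonneg_pos\<close>)
  finally have Fa: "ln x \<le> F a" .
  have "(F \<longlongrightarrow> (\<Sum>p\<in>A. 0)) at_top"
    unfolding F_def
  proof (rule tendsto_sum)
    fix p assume "p \<in> A"
    hence p: "1 < real p" by (rule gt1)
    have "filterlim (\<lambda>a. real p powr a) at_top at_top"
    proof -
      have "filterlim (\<lambda>a. ln (real p) * a) at_top at_top"
        using p by (intro filterlim_tendsto_pos_mult_at_top[OF tendsto_const]) (auto simp: filterlim_ident)
      hence "filterlim (\<lambda>a. exp (ln (real p) * a)) at_top at_top"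
        by (rule filterlim_compose[OF exp_at_top])
      thus ?thesis using p by (simp add: powr_def mult.commute)
    qed
    hence "filterlim (\<lambda>a. -1 + real p powr a) at_top at_top"
      by (rule filterlim_tendsto_add_at_top[OF tendsto_const])
    hence "filterlim (\<lambda>a. real p powr a - 1) at_top at_top" by simp
    thus "((\<lambda>a. ln (real p) / (real p powr a - 1)) \<longlongrightarrow> 0) at_top"
      by (intro tendsto_divide_0[OF tendsto_const] filterlim_at_top_imp_at_infinity)
  qed
  hence "eventually (\<lambda>b. F b < ln x) at_top"
    using lnx by (intro order_tendstoD(2)) auto
  then obtain b where b: "a \<le> b" "F b < ln x"
    by (metis (no_types, lifting) eventually_at_top_linorder linorder_linear)
  have "continuous_on {a..b} F"
    unfolding F_def
  proof (intro continuous_intros ballI)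
    fix p t assume pt: "p \<in> A" "t \<in> {a..b}"
    show "real p powr t - 1 \<noteq> 0"
      using pow[OF pt(1), of t] pt(2) a(1) by simp
    show "real p \<noteq> 0" using gt1[OF pt(1)] by simp
  qed
  then obtain c where c: "a \<le> c" "F c = ln x"
    using IVT2'[of F b "ln x" a] Fa b by force
  show ?thesis
  proof (rule ex1I[of _ c])
    fix d
    assume "0 < d \<and> (\<Sum>p | prime p \<and> real p \<le> y. ln (real p) / (real p powr d - 1)) = ln x"
    hence "0 < d" "F d = F c" using c by (auto simp: F_def A_def)
    thus "d = c" using anti[of d c] anti[of c d] c a by (cases d c rule: linorder_cases) auto
  qed (use c a in \<open>auto simp: F_def A_def\<close>)
qed

end

theory Submission
  imports Defs "HOL-Analysis.Infinite_Sum" "HOL-Analysis.Convex" "HOL-Analysis.Elementary_Metric_Spaces"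
begin

text \<open>
  Write \<open>l = log x\<close>, \<open>u = log x / log y\<close>, and let \<open>\<zeta>(s, y)\<close> be the product of
  \<open>1 / (1 - p\<^sup>-\<^sup>s)\<close> over the primes \<open>p \<le> y\<close>.  By orthogonality the mean square of the inner sum over
  the characters is at most \<open>\<Psi>(x, y)\<close>, so Cauchy--Schwarz alone gives the square root of \<open>\<Psi>(x, y)\<close>
  for the mean absolute value.  The exponent of the Gaussian factor in \<open>S(x, y, q)\<close> is at least
  \<open>-u/16\<close>, so \<open>S \<ge> l\<^sup>3\<^sup>/\<^sup>2 (log y)\<^sup>1\<^sup>/\<^sup>2 exp(-u/16)\<close>, and what has to be gained is a factor
  exponentially small in \<open>u\<close>.  Powers of \<open>l\<close> are cheap beside it, since
  \<open>u \<ge> 32 log l\<close> by the upper bound on \<open>y\<close>.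

  The gain comes from the many factorisations \<open>n = a b\<close> of a smooth number.  The constant function
  one is the Dirichlet convolution of \<open>2\<^sup>-\<^sup>\<Omega>\<close> and \<open>2\<^sup>-\<^sup>\<omega>\<close>
  (\<open>sum_divisors_half_powers\<close>), so the inner sum is a bilinear form over \<open>a b \<le> x\<close> whose coefficients
  have squares at most \<open>4\<^sup>-\<^sup>\<Omega>\<^sup>(\<^sup>a\<^sup>)\<close> and \<open>4\<^sup>-\<^sup>\<omega>\<^sup>(\<^sup>b\<^sup>)\<close>.  The hyperbolic
  region splits into dyadic families of rectangles, with \<open>O(l)\<close> families
  (\<open>dyadic_hyperbola_bound\<close>).  On one rectangle, Cauchy--Schwarz over the characters, Bessel's
  inequality (\<open>dirichlet_char_bessel\<close>, where \<open>a, b \<le> x \<le> q\<close> makes distinct integers distinct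
  residues) and Rankin's trick with an exponent \<open>s\<close> bound the mean.  The Euler factors of the two
  weights multiply to at most \<open>exp(-p\<^sup>-\<^sup>s / 2)\<close> times that of \<open>\<zeta>\<close>
  (\<open>square_root_weights_le\<close>), so the squared mean is at most
  \<open>9 l\<^sup>2 x\<^sup>s \<zeta>(s, y) exp(-\<Sum> p\<^sup>-\<^sup>s / 2)\<close> (\<open>mean_char_sum_rankin\<close>).

  It remains to compare \<open>x\<^sup>s \<zeta>(s, y)\<close> with \<open>\<Psi>(x, y)\<close>.  Take \<open>s\<close> to be the saddle point belonging
  to \<open>x\<^sup>0\<^sup>.\<^sup>9\<^sup>9\<^sup>8\<close>.  The probability measure on smooth \<open>n\<close> with weights proportional to
  \<open>n\<^sup>-\<^sup>s\<close> has \<open>0.998 l\<close> as the mean of \<open>log n\<close>, and a Chernoff bound puts half of its mass between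
  \<open>x\<^sup>0\<^sup>.\<^sup>9\<^sup>9\<^sup>7\<close> and \<open>x\<close> (\<open>rankin_measure_concentration\<close>).  Multiplying by primes in
  \<open>(\<surd>y, y]\<close> carries this mass into the top window \<open>(x/y, x]\<close> with the loss of at most a constant
  times \<open>exp(0.024 u)\<close> (\<open>mass_top_window\<close>), and a Chebyshev count of the primes below \<open>x/m\<close> turns
  the mass there into a number of smooth integers (\<open>smooth_count_ge_mass\<close>).  Hence
  \<open>x\<^sup>s \<zeta>(s, y)\<close> is at most a constant times \<open>l exp(0.024 u) \<Psi>(x, y)\<close>.  The saddle point equation
  also forces \<open>\<Sum> p\<^sup>-\<^sup>s \<ge> 0.285 u\<close>, provided that \<open>s \<ge> 1/2\<close>; that is what
  \<open>y \<ge> l\<^sup>6\<close> and Mertens' estimate give (\<open>saddle_exponent\<close>).  In total the squared mean is at most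
  a constant times \<open>l\<^sup>3 exp(-0.118 u) \<Psi>(x, y)\<close>, which suffices because
  \<open>0.118 - 1/16 > (3/2)/32\<close>.  Bounded \<open>x\<close> are covered by the trivial bound \<open>\<Psi>(x, y)\<close>.
\<close>

section \<open>Characters modulo \<open>q\<close>\<close>

lemma dirichlet_char_mult: "dirichlet_char q \<chi> \<Longrightarrow> \<chi> (m * n) = \<chi> m * \<chi> n"
  by (simp add: dirichlet_char_def)

lemma dirichlet_char_cong:
  assumes "dirichlet_char q \<chi>" "m mod q = n mod q"
  shows "\<chi> m = \<chi> n"
  using dirichlet_char_mod[OF assms(1)] assms(2) by metis

lemma norm_dirichlet_char:
  assumes "dirichlet_char q \<chi>" "0 < q"
  shows "norm (\<chi> n) = (if coprime n q then 1 else 0)"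
proof (cases "coprime n q")
  case True
  have pow: "\<chi> (n ^ k) = \<chi> n ^ k" for k
    using assms by (induction k) (simp_all add: dirichlet_char_def)
  have "n ^ totient q mod q = 1 mod q"
    using euler_theorem[OF True] by (simp add: cong_def)
  hence "\<chi> (n ^ totient q) = \<chi> 1"
    using dirichlet_char_cong[OF assms(1)] by blast
  hence "norm (\<chi> n) ^ totient q = 1"
    using assms by (simp add: pow dirichlet_char_def flip: norm_power)
  moreover have "totient q > 0" using assms by simp
  ultimately have "norm (\<chi> n) = 1"
    by (metis norm_ge_zero power_eq_1_iff norm_of_real abs_of_nonneg gr_implies_not0 real_norm_def)
  thus ?thesis using True by simp
next
  case False
  thus ?thesis using assms by (auto simp: dirichlet_char_def)
qed

lemma norm_dirichlet_char_le_1: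
  assumes "dirichlet_char q \<chi>" "0 < q"
  shows "norm (\<chi> n) \<le> 1"
  using norm_dirichlet_char[OF assms, of n] by simp

text \<open>Multiplication by some \<open>m\<close> with \<open>\<chi> m \<noteq> \<psi> m\<close> permutes the residues and multiplies the sum by
  \<open>\<chi> m * cnj (\<psi> m)\<close>, which differs from one because \<open>\<psi> m\<close> has absolute value one.\<close>

lemma dirichlet_char_orthogonal:
  assumes \<chi>: "dirichlet_char q \<chi>" and \<psi>: "dirichlet_char q \<psi>" and ne: "\<chi> \<noteq> \<psi>" and q: "0 < q"
  shows "(\<Sum>n\<in>{1..q}. \<chi> n * cnj (\<psi> n)) = 0"
proof -
  obtain m where m: "\<chi> m \<noteq> \<psi> m" using ne by auto
  have cop: "coprime m q"
    using m \<chi> \<psi> unfolding dirichlet_char_def by metis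
  have \<psi>m: "\<psi> m * cnj (\<psi> m) = 1"
    using norm_dirichlet_char[OF \<psi> q, of m] cop complex_norm_square[of "\<psi> m"] by simp
  define g where "g n = \<chi> n * cnj (\<psi> n)" for n
  define T where "T = (\<Sum>n<q. g n)"
  have gmod: "g (n mod q) = g n" for n
    unfolding g_def by (simp add: dirichlet_char_mod[OF \<chi>] dirichlet_char_mod[OF \<psi>])
  let ?f = "\<lambda>n. m * n mod q"
  have inj: "inj_on ?f {..<q}"
  proof (rule inj_onI)
    fix a b assume ab: "a \<in> {..<q}" "b \<in> {..<q}" "m * a mod q = m * b mod q"
    hence "[m * a = m * b] (mod q)" by (simp add: cong_def)
    hence "[a = b] (mod q)" using cop by (metis cong_mult_lcancel_nat)
    thus "a = b" using ab by (simp add: cong_def)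
  qed
  have img: "?f ` {..<q} = {..<q}"
    by (rule endo_inj_surj[OF _ _ inj]) (use q in auto)
  have "T = (\<Sum>n\<in>?f ` {..<q}. g n)" by (simp only: img T_def)
  also have "\<dots> = (\<Sum>n<q. g (m * n))"
    using inj by (simp add: sum.reindex gmod)
  also have "\<dots> = g m * T"
    by (simp add: g_def T_def sum_distrib_left dirichlet_char_mult[OF \<chi>] dirichlet_char_mult[OF \<psi>] mult_ac)
  finally have "T = 0 \<or> g m = 1" by simp
  moreover have "g m \<noteq> 1"
  proof
    assume "g m = 1"
    hence "\<chi> m * (\<psi> m * cnj (\<psi> m)) = \<psi> m" by (simp add: g_def mult_ac)
    thus False using m \<psi>m by simp
  qed
  ultimately have "T = 0" by blast
  moreover have "(\<Sum>n\<in>{1..q}. g n) = T"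
  proof -
    have "{..q} = insert q {..<q}" "{..q} = insert 0 {1..q}" by auto
    hence "g q + T = g 0 + (\<Sum>n\<in>{1..q}. g n)" unfolding T_def
      by (metis (no_types, lifting) sum.insert finite_lessThan finite_atLeastAtMost lessThan_iff
          less_irrefl atLeastAtMost_iff not_one_le_zero)
    moreover have "g q = g 0" using gmod[of q] by simp
    ultimately show ?thesis by simp
  qed
  ultimately show ?thesis by (simp add: g_def)
qed

lemma dirichlet_char_norm_sq:
  assumes "dirichlet_char q \<chi>" and q: "0 < q"
  shows "(\<Sum>n\<in>{1..q}. \<chi> n * cnj (\<chi> n)) = of_nat (totient q)"
proof -
  have "(\<Sum>n\<in>{1..q}. \<chi> n * cnj (\<chi> n)) = (\<Sum>n\<in>{1..q}. if coprime n q then 1 else 0)"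
    by (rule sum.cong) (simp_all add: complex_norm_square[symmetric] norm_dirichlet_char[OF assms])
  also have "\<dots> = of_nat (card {n\<in>{1..q}. coprime n q})"
    by (simp add: sum.If_cases Int_def)
  also have "{n\<in>{1..q}. coprime n q} = totatives q"
    by (auto simp: totatives_def)
  finally show ?thesis by (simp add: totient_def)
qed

text \<open>The characters are orthogonal vectors of squared length \<open>totient q\<close> in the space of functions on
  \<open>{1..q}\<close>.  Bessel's inequality follows by duality: the left side \<open>T\<close> is the pairing of
  \<open>c\<close> with a combination of characters whose squared length is \<open>totient q * T\<close>.\<close>

lemma dirichlet_char_bessel:
  fixes c :: "nat \<Rightarrow> complex"
  assumes q: "0 < q" and I: "I \<subseteq> {1..q}"
  shows "(\<Sum>\<chi>\<in>dirichlet_chars q. (norm (\<Sum>a\<in>I. c a * \<chi> a))\<^sup>2)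
           \<le> real (totient q) * (\<Sum>a\<in>I. (norm (c a))\<^sup>2)"
proof -
  define X where "X = dirichlet_chars q"
  have finX: "finite X" using finite_dirichlet_chars[OF q] by (simp add: X_def)
  have finI: "finite I" using I finite_subset by blast
  define S where "S \<chi> = (\<Sum>a\<in>I. c a * \<chi> a)" for \<chi>
  define D where "D a = (\<Sum>\<chi>\<in>X. cnj (S \<chi>) * \<chi> a)" for a
  define T where "T = (\<Sum>\<chi>\<in>X. (norm (S \<chi>))\<^sup>2)"
  have T0: "T \<ge> 0" unfolding T_def by (intro sum_nonneg) auto
  have "complex_of_real T = (\<Sum>\<chi>\<in>X. cnj (S \<chi>) * S \<chi>)"
    unfolding T_def of_real_sum by (intro sum.cong refl) (simp add: complex_norm_square mult.commute del: of_real_power)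
  also have "\<dots> = (\<Sum>\<chi>\<in>X. \<Sum>a\<in>I. c a * (cnj (S \<chi>) * \<chi> a))"
    by (intro sum.cong refl) (subst (2) S_def, simp add: sum_distrib_left mult_ac)
  also have "\<dots> = (\<Sum>a\<in>I. c a * D a)"
    by (subst sum.swap) (simp add: D_def sum_distrib_left)
  finally have "T = norm (\<Sum>a\<in>I. c a * D a)"
    using T0 by (metis norm_of_real abs_of_nonneg)
  also have "\<dots> \<le> (\<Sum>a\<in>I. norm (c a) * norm (D a))"
    by (rule order_trans[OF norm_sum]) (simp add: norm_mult)
  finally have "T\<^sup>2 \<le> (\<Sum>a\<in>I. norm (c a) * norm (D a))\<^sup>2"
    using T0 by (intro power_mono)
  also have "\<dots> \<le> (\<Sum>a\<in>I. (norm (c a))\<^sup>2) * (\<Sum>a\<in>I. (norm (D a))\<^sup>2)"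
    by (rule Cauchy_Schwarz_ineq_sum)
  also have "\<dots> \<le> (\<Sum>a\<in>I. (norm (c a))\<^sup>2) * (real (totient q) * T)"
  proof (rule mult_left_mono)
    have "(\<Sum>a\<in>I. (norm (D a))\<^sup>2) \<le> (\<Sum>a\<in>{1..q}. (norm (D a))\<^sup>2)"
      by (rule sum_mono2) (use I in auto)
    moreover have "complex_of_real (\<Sum>a\<in>{1..q}. (norm (D a))\<^sup>2) = of_real (real (totient q) * T)"
    proof -
      have "complex_of_real (\<Sum>a\<in>{1..q}. (norm (D a))\<^sup>2) = (\<Sum>a\<in>{1..q}. D a * cnj (D a))"
        unfolding of_real_sum by (intro sum.cong refl) (simp add: complex_norm_square del: of_real_power)
      also have "\<dots> = (\<Sum>a\<in>{1..q}. \<Sum>\<chi>\<in>X. \<Sum>\<psi>\<in>X. cnj (S \<chi>) * S \<psi> * (\<chi> a * cnj (\<psi> a)))"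
        by (simp add: D_def cnj_sum sum_product mult_ac)
      also have "\<dots> = (\<Sum>\<chi>\<in>X. \<Sum>\<psi>\<in>X. cnj (S \<chi>) * S \<psi> * (\<Sum>a\<in>{1..q}. \<chi> a * cnj (\<psi> a)))"
        by (subst sum.swap, intro sum.cong refl, subst sum.swap) (simp add: sum_distrib_left)
      also have "\<dots> = (\<Sum>\<chi>\<in>X. \<Sum>\<psi>\<in>X. if \<psi> = \<chi> then cnj (S \<chi>) * S \<chi> * of_nat (totient q) else 0)"
        by (intro sum.cong refl)
           (auto simp: X_def dirichlet_chars_def dirichlet_char_norm_sq[OF _ q, unfolded One_nat_def] dirichlet_char_orthogonal[OF _ _ _ q, unfolded One_nat_def])
      also have "\<dots> = (\<Sum>\<chi>\<in>X. cnj (S \<chi>) * S \<chi> * of_nat (totient q))"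
        using finX by simp
      also have "\<dots> = of_real (real (totient q) * T)"
        unfolding T_def of_real_mult of_real_sum sum_distrib_left
        by (intro sum.cong refl) (simp add: complex_norm_square mult_ac del: of_real_power)
      finally show ?thesis .
    qed
    ultimately show "(\<Sum>a\<in>I. (norm (D a))\<^sup>2) \<le> real (totient q) * T"
      by (metis of_real_eq_iff)
  qed (auto intro: sum_nonneg)
  finally have "T * T \<le> (real (totient q) * (\<Sum>a\<in>I. (norm (c a))\<^sup>2)) * T"
    by (simp add: power2_eq_square mult_ac)
  hence "T \<le> real (totient q) * (\<Sum>a\<in>I. (norm (c a))\<^sup>2)"
    using T0 by (cases "T = 0") (auto intro!: mult_nonneg_nonneg sum_nonneg)
  thus ?thesis by (simp add: T_def S_def X_def)
qed

text \<open>Bessel's inequality for the indicator function of \<open>1\<close>, where every character takes the value one.\<close>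

lemma card_dirichlet_chars_le:
  assumes q: "0 < q"
  shows "card (dirichlet_chars q) \<le> totient q"
proof -
  have "real (card (dirichlet_chars q)) = (\<Sum>\<chi>\<in>dirichlet_chars q. (norm (\<Sum>a\<in>{1}. 1 * \<chi> a))\<^sup>2)"
    by (simp add: dirichlet_chars_def dirichlet_char_def)
  also have "\<dots> \<le> real (totient q) * (\<Sum>a\<in>{1::nat}. (norm (1::complex))\<^sup>2)"
    by (rule dirichlet_char_bessel[OF q]) (use q in auto)
  finally show ?thesis by simp
qed

section \<open>Smooth numbers and their Euler products\<close>

definition smooth_over :: "nat set \<Rightarrow> nat set" where
  "smooth_over P = {n. 0 < n \<and> prime_factors n \<subseteq> P}"

lemma smooth_upto_altdef:
  assumes "1 \<le> y"
  shows "smooth_upto x y = {n \<in> smooth_over {p. prime p \<and> real p \<le> y}. real n \<le> x}"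
  unfolding smooth_upto_def smooth_over_def largest_prime_factor_le_iff[OF assms]
  by (auto simp: prime_factors_dvd)

text \<open>Smoothness of a product separates into smoothness of its factors; this is what lets the bilinear
  form below run over smooth \<open>a\<close> and \<open>b\<close> independently.\<close>

lemma smooth_over_mult_iff:
  assumes "0 < m" "0 < n"
  shows "m * n \<in> smooth_over P \<longleftrightarrow> m \<in> smooth_over P \<and> n \<in> smooth_over P"
  using assms by (auto simp: smooth_over_def prime_factors_product)

lemma multiplicity_coprime_mult_power:
  fixes p m :: nat
  assumes "prime p" "\<not> p dvd m"
  shows "multiplicity p (m * p ^ k) = k"
  by (rule multiplicity_decomposeI[of _ _ _ m]) (use assms in \<open>auto simp: mult.commute\<close>)

lemma coprime_mult_power_eq_iff:
  fixes p m m' :: nat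
  assumes "prime p" "\<not> p dvd m" "\<not> p dvd m'"
  shows "m * p ^ j = m' * p ^ k \<longleftrightarrow> m = m' \<and> j = k"
proof
  assume eq: "m * p ^ j = m' * p ^ k"
  hence "j = k" using multiplicity_coprime_mult_power assms by metis
  moreover have "p > 0" using assms(1) prime_gt_0_nat by blast
  ultimately show "m = m' \<and> j = k" using eq by simp
qed simp

text \<open>The Euler product for a finite set of primes and a nonnegative multiplicative function, which
  need not be completely multiplicative: \<open>g p k\<close> is its value at \<open>p ^ k\<close>.  Adding a prime \<open>p\<close> replaces
  the range of summation by pairs \<open>(m, k)\<close> through \<open>n = m * p ^ k\<close>.\<close>

lemma has_sum_smooth_over:
  fixes f :: "nat \<Rightarrow> real"
  assumes "finite P" "\<And>p. p \<in> P \<Longrightarrow> prime p"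
    and f1: "f 1 = 1" and nonneg: "\<And>n. f n \<ge> 0"
    and mult: "\<And>p m k. p \<in> P \<Longrightarrow> 0 < m \<Longrightarrow> \<not> p dvd m \<Longrightarrow> f (m * p ^ k) = f m * g p k"
    and G: "\<And>p. p \<in> P \<Longrightarrow> (g p has_sum G p) UNIV"
  shows "(f has_sum (\<Prod>p\<in>P. G p)) (smooth_over P)"
  using assms(1,2) mult G
proof (induction P rule: finite_induct)
  case empty
  have "smooth_over {} = {1}"
    by (auto simp: smooth_over_def prime_factorization_empty_iff)
  thus ?case using f1 by (simp add: has_sum_finite_iff)
next
  case (insert p P)
  have p: "prime p" using insert.prems by simp
  have IH: "(f has_sum (\<Prod>p\<in>P. G p)) (smooth_over P)"
    by (rule insert.IH) (use insert.prems in auto)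
  have ndvd: "0 < m \<and> \<not> p dvd m" if "m \<in> smooth_over P" for m
    using that p insert.hyps(2) by (auto simp: smooth_over_def prime_factors_dvd)
  let ?h = "\<lambda>(m, k). m * p ^ k"
  have inj: "inj_on ?h (smooth_over P \<times> UNIV)"
    using ndvd coprime_mult_power_eq_iff[OF p] by (auto intro!: inj_onI)
  have img: "?h ` (smooth_over P \<times> UNIV) = smooth_over (insert p P)"
  proof (intro equalityI subsetI)
    fix n assume "n \<in> ?h ` (smooth_over P \<times> UNIV)"
    then obtain m k where "m \<in> smooth_over P" "n = m * p ^ k" by auto
    moreover have "prime_factors (p ^ k) \<subseteq> {p}" using p by (cases "k = 0") (auto simp: prime_factorization_prime_power)
    ultimately show "n \<in> smooth_over (insert p P)"
      using p prime_gt_0_nat[OF p] by (auto simp: smooth_over_def prime_factors_product)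
  next
    fix n assume n: "n \<in> smooth_over (insert p P)"
    have n0: "n \<noteq> 0" "\<not> is_unit p" using n p by (auto simp: smooth_over_def)
    obtain m where m: "n = p ^ multiplicity p n * m" "\<not> p dvd m"
      using multiplicity_decompose'[OF n0] by blast
    have m0: "0 < m" using m n by (auto simp: smooth_over_def intro: Nat.gr0I)
    have "p \<notin> prime_factors m" using m(2) by auto
    moreover have "prime_factors m \<subseteq> insert p P"
      using n m0 prime_gt_0_nat[OF p] unfolding smooth_over_def by (subst (asm) m(1)) (auto simp: prime_factors_product)
    ultimately have "m \<in> smooth_over P" using m0 by (auto simp: smooth_over_def)
    thus "n \<in> ?h ` (smooth_over P \<times> UNIV)" using m(1) by (auto simp: mult.commute image_iff)
  qed
  have eq: "f (?h x) = f (fst x) * g p (snd x)" if "x \<in> smooth_over P \<times> UNIV" for x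
    using that ndvd insert.prems(2)[of p] by (auto split: prod.splits)
  have Gp: "(g p has_sum G p) UNIV" using insert.prems by simp
  have sg: "((\<lambda>x. f (fst x) * g p (snd x)) has_sum ((\<Prod>p\<in>P. G p) * G p)) (smooth_over P \<times> UNIV)"
  proof (rule has_sum_SigmaI[where g = "\<lambda>m. f m * G p"])
    show "((\<lambda>k. f (fst (m, k)) * g p (snd (m, k))) has_sum f m * G p) UNIV" for m
      using has_sum_cmult_right[OF Gp] by simp
    show "((\<lambda>m. f m * G p) has_sum (\<Prod>p\<in>P. G p) * G p) (smooth_over P)"
      by (rule has_sum_cmult_left[OF IH])
    have "(\<lambda>(m, k). f m * g p k) summable_on (smooth_over P \<times> UNIV)"
    proof (rule summable_on_SigmaI[where g = "\<lambda>m. f m * G p"], goal_cases)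
      case (1 m)
      show ?case using has_sum_cmult_right[OF Gp] by simp
    next
      case 2
      show ?case using has_sum_cmult_left[OF IH] by (rule has_sum_imp_summable)
    next
      case (3 m k)
      thus ?case using nonneg[of "m * p ^ k"] ndvd[of m] insert.prems(2)[of p m k] by auto
    qed
    thus "(\<lambda>x. f (fst x) * g p (snd x)) summable_on (smooth_over P \<times> UNIV)"
      by (simp add: case_prod_unfold)
  qed
  hence "((\<lambda>x. f (?h x)) has_sum ((\<Prod>p\<in>P. G p) * G p)) (smooth_over P \<times> UNIV)"
    by (subst has_sum_cong[OF eq])
  hence "(f has_sum ((\<Prod>p\<in>P. G p) * G p)) (?h ` (smooth_over P \<times> UNIV))"
    by (subst has_sum_reindex[OF inj]) (simp add: o_def)
  thus ?case using insert.hyps by (simp add: img mult.commute)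
qed

section \<open>A square-root factorisation of the constant function one\<close>

text \<open>The number of prime factors with multiplicity, \<open>\<Omega>(n)\<close>, and the number of distinct ones,
  \<open>\<omega>(n)\<close>.\<close>

definition big_omega :: "nat \<Rightarrow> nat" where
  "big_omega n = size (prime_factorization n)"

definition small_omega :: "nat \<Rightarrow> nat" where
  "small_omega n = card (prime_factors n)"

lemma big_omega_mult_prime_power:
  assumes "prime p" "0 < m"
  shows "big_omega (m * p ^ k) = big_omega m + k"
  using assms prime_gt_0_nat[of p]
  by (simp add: big_omega_def prime_factorization_mult prime_factorization_prime_power)

lemma small_omega_mult_prime_power:
  assumes "prime p" "0 < m" "\<not> p dvd m"
  shows "small_omega (m * p ^ k) = small_omega m + (if k = 0 then 0 else 1)"
proof -
  have "p \<notin> prime_factors m" using assms by auto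
  thus ?thesis using assms prime_gt_0_nat[of p]
    by (simp add: small_omega_def prime_factors_product prime_factorization_prime_power)
qed

lemma divisors_coprime_mult_prime_power:
  fixes p m :: nat
  assumes p: "prime p"
  shows "{d. d dvd m * p ^ k} = (\<lambda>(d, j). d * p ^ j) ` ({d. d dvd m} \<times> {..k})"
proof (intro equalityI subsetI)
  fix d assume "d \<in> {d. d dvd m * p ^ k}"
  then obtain b c where "d = b * c" "b dvd m" "c dvd p ^ k"
    using division_decomp by blast
  thus "d \<in> (\<lambda>(d, j). d * p ^ j) ` ({d. d dvd m} \<times> {..k})"
    using divides_primepow_nat[OF p] by force
next
  fix d assume "d \<in> (\<lambda>(d, j). d * p ^ j) ` ({d. d dvd m} \<times> {..k})"
  thus "d \<in> {d. d dvd m * p ^ k}" by (auto intro!: mult_dvd_mono le_imp_power_dvd)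
qed

text \<open>With \<open>X = p\<^sup>-\<^sup>s\<close>, the Dirichlet series of \<open>2\<^sup>-\<^sup>\<Omega>\<close> has the Euler factor \<open>1 / (1 - X/2)\<close> and
  that of \<open>2\<^sup>-\<^sup>\<omega>\<close> has \<open>1 + (X/2) / (1 - X) = (1 - X/2) / (1 - X)\<close>; their product is the factor
  \<open>1 / (1 - X)\<close> of \<open>\<zeta>\<close>.  Both functions are about \<open>1/2\<close> at a prime, so each is a substitute with rational
  values for the convolution square root of the constant one.\<close>

lemma sum_divisors_half_powers:
  assumes "0 < n"
  shows "(\<Sum>d | d dvd n. (1/2) ^ big_omega d * (1/2) ^ small_omega (n div d)) = (1::real)"
  using assms
proof (induction n rule: less_induct)
  case (less n)
  show ?case
  proof (cases "n = 1")
    case True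
    thus ?thesis by (simp add: big_omega_def small_omega_def)
  next
    case False
    then obtain p where p: "prime p" "p dvd n" using prime_factor_nat by blast
    define k where "k = multiplicity p n"
    have n0: "n \<noteq> 0" "\<not> is_unit p" using less.prems p by auto
    obtain m where m: "n = p ^ k * m" "\<not> p dvd m"
      using multiplicity_decompose'[OF n0] unfolding k_def by blast
    have k: "0 < k" using p m by (cases "k = 0") auto
    have m0: "0 < m" using m less.prems by (auto intro: Nat.gr0I)
    have "1 < p ^ k" using k prime_gt_1_nat[OF p(1)] by (intro one_less_power)
    hence "m < n" using m m0 by simp
    note IH = less.IH[OF this m0]
    have nm: "n = m * p ^ k" using m by simp
    have nd: "\<not> p dvd d" if "d dvd m" for d using that m(2) dvd_trans by blast
    have inj: "inj_on (\<lambda>(d, j). d * p ^ j) ({d. d dvd m} \<times> {..k})"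
      using nd coprime_mult_power_eq_iff[OF p(1)] by (auto intro!: inj_onI)
    let ?F = "\<lambda>d e. (1/2) ^ big_omega d * (1/2) ^ small_omega e :: real"
    have term_eq: "?F (d * p ^ j) (n div (d * p ^ j))
        = ?F d (m div d) * ((1/2) ^ j * (if j = k then 1 else 1/2))" if dj: "d dvd m" "j \<le> k" for d j
    proof -
      obtain e where e: "m = d * e" using dj by auto
      have de: "0 < d" "0 < e" using e m0 by auto
      have pe: "\<not> p dvd e" using e m(2) by auto
      have "n div (d * p ^ j) = e * p ^ (k - j)"
      proof -
        have "n = (d * p ^ j) * (e * p ^ (k - j))"
          using dj by (simp add: nm e mult_ac flip: power_add)
        thus ?thesis using de prime_gt_0_nat[OF p(1)] by simp
      qed
      moreover have "m div d = e" using e de by simp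
      ultimately show ?thesis
        using dj by (simp add: big_omega_mult_prime_power[OF p(1) de(1)]
          small_omega_mult_prime_power[OF p(1) de(2) pe] power_add)
    qed
    have geo: "(\<Sum>j\<le>k. (1/2) ^ j * (if j = k then 1 else 1/2)) = (1::real)" for k :: nat
    proof -
      have "(\<Sum>j<k. (1/2) ^ j * (1/2)) = 1 - (1/2::real) ^ k"
        by (induction k) (auto simp: field_simps)
      thus ?thesis by (simp add: lessThan_Suc_atMost[symmetric])
    qed
    have "(\<Sum>d | d dvd n. ?F d (n div d)) = (\<Sum>(d, j)\<in>{d. d dvd m} \<times> {..k}. ?F (d * p ^ j) (n div (d * p ^ j)))"
      unfolding nm divisors_coprime_mult_prime_power[OF p(1)]
      by (subst sum.reindex[OF inj]) (simp add: case_prod_unfold)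
    also have "\<dots> = (\<Sum>(d, j)\<in>{d. d dvd m} \<times> {..k}. ?F d (m div d) * ((1/2) ^ j * (if j = k then 1 else 1/2)))"
      by (rule sum.cong) (auto simp: term_eq)
    also have "\<dots> = (\<Sum>d | d dvd m. ?F d (m div d)) * (\<Sum>j\<le>k. (1/2) ^ j * (if j = k then 1 else 1/2))"
      by (simp only: sum_product sum.cartesian_product)
    finally show ?thesis using IH geo by simp
  qed
qed

lemma sum_divisors_eq_hyperbola:
  fixes F :: "nat \<Rightarrow> nat \<Rightarrow> 'a::comm_monoid_add"
  shows "(\<Sum>n=1..N. \<Sum>d | d dvd n. F d (n div d)) = (\<Sum>a=1..N. \<Sum>b=1..N div a. F a b)"
proof -
  have "(\<Sum>n=1..N. \<Sum>d | d dvd n. F d (n div d)) = (\<Sum>(n, d)\<in>(SIGMA n:{1..N}. {d. d dvd n}). F d (n div d))"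
    by (rule sum.Sigma) auto
  also have "\<dots> = (\<Sum>(a, b)\<in>(SIGMA a:{1..N}. {1..N div a}). F a b)"
  proof (rule sum.reindex_bij_witness[of _ "\<lambda>(a, b). (a * b, a)" "\<lambda>(n, d). (d, n div d)"], goal_cases)
    case (2 x)
    then obtain n d where x: "x = (n, d)" "1 \<le> n" "n \<le> N" "d dvd n" by auto
    have "1 \<le> d" "d \<le> N" using x dvd_imp_le[of d n] by (auto intro: Suc_leI Nat.gr0I)
    moreover have "1 \<le> n div d" using x by (auto simp: Suc_le_eq div_greater_zero_iff intro: dvd_imp_le Nat.gr0I)
    moreover have "n div d \<le> N div d" using x by (simp add: div_le_mono)
    ultimately show ?case using x by simp
  next
    case (4 x)
    then obtain a b where x: "x = (a, b)" "1 \<le> a" "a \<le> N" "1 \<le> b" "b \<le> N div a" by auto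
    have "a * b \<le> N" using x by (metis less_eq_div_iff_mult_less_eq mult.commute Suc_le_eq One_nat_def)
    thus ?case using x by simp
  qed auto
  also have "\<dots> = (\<Sum>a=1..N. \<Sum>b=1..N div a. F a b)"
    by (rule sum.Sigma[symmetric]) auto
  finally show ?thesis .
qed

section \<open>Cutting the hyperbola into rectangles\<close>

lemma sqrt_mult_superadditive:
  fixes a b c d :: real
  assumes "0 \<le> a" "0 \<le> b" "0 \<le> c" "0 \<le> d"
  shows "sqrt (a * b) + sqrt (c * d) \<le> sqrt ((a + c) * (b + d))"
proof (rule real_le_rsqrt)
  have "sqrt (a * b) * sqrt (c * d) = sqrt ((a * d) * (b * c))"
    by (simp add: real_sqrt_mult mult_ac)
  also have "\<dots> \<le> (a * d + b * c) / 2"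
    using assms by (intro arith_geo_mean_sqrt) auto
  finally show "(sqrt (a * b) + sqrt (c * d))\<^sup>2 \<le> (a + c) * (b + d)"
    using assms by (simp add: power2_sum algebra_simps)
qed

text \<open>An exact separation of the variables in \<open>a b \<le> N\<close>.  For a dyadic interval of \<open>a\<close>, the part of the region above the level \<open>N div (c + 2 ^ k)\<close> is the
  union of the same part for each half and of one rectangle over the left half.  At a fixed level of
  the recursion the rectangles use disjoint ranges of \<open>a\<close> and disjoint ranges of \<open>b\<close>, so the sum of their
  bounds is again bounded by the full \<open>U\<close> and \<open>V\<close> sums, and each of the \<open>k\<close> levels costs the same.\<close>

lemma dyadic_hyperbola_bound:
  fixes F G :: "'x \<Rightarrow> nat \<Rightarrow> complex" and U V :: "nat \<Rightarrow> real"
  assumes U: "\<And>a. U a \<ge> 0" and V: "\<And>b. V b \<ge> 0" and K: "K \<ge> 0"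
    and rect: "\<And>c m d e. m * e \<le> N \<Longrightarrow>
      (\<Sum>x\<in>X. norm (\<Sum>a\<in>{c<..m}. F x a) * norm (\<Sum>b\<in>{d<..e}. G x b))
        \<le> K * sqrt ((\<Sum>a\<in>{c<..m}. U a) * (\<Sum>b\<in>{d<..e}. V b))"
    and k: "N < 2 ^ k"
  shows "(\<Sum>x\<in>X. norm (\<Sum>a=1..N. F x a * (\<Sum>b=1..N div a. G x b)))
           \<le> K * k * sqrt ((\<Sum>a=1..2^k. U a) * (\<Sum>b=1..N. V b))"
proof -
  define SU where "SU c m = (\<Sum>a\<in>{c<..m}. U a)" for c m
  define SV where "SV c m = (\<Sum>a\<in>{c<..m}. V a)" for c m
  define R where "R c k x = (\<Sum>a\<in>{c<..c + 2 ^ k}. F x a * (\<Sum>b\<in>{N div (c + 2 ^ k)<..N div a}. G x b))"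
    for c k x
  have SU0: "SU c m \<ge> 0" and SV0: "SV c m \<ge> 0" for c m
    unfolding SU_def SV_def using U V by (auto intro: sum_nonneg)
  have SVmono: "SV c m \<le> SV c m'" if "m \<le> m'" for c m m'
    unfolding SV_def using that V by (intro sum_mono2) auto
  have main: "(\<Sum>x\<in>X. norm (R c k x))
     \<le> K * k * sqrt (SU c (c + 2 ^ k) * SV (N div (c + 2 ^ k)) (N div (c + 1)))" for c k
  proof (induction k arbitrary: c)
    case 0
    have "{c<..c + 2 ^ 0} = {Suc c}" by auto
    thus ?case by (simp add: R_def)
  next
    case (Suc k)
    define m where "m = c + 2 ^ k"
    define e where "e = c + 2 ^ Suc k"
    have em: "e = m + 2 ^ k" "c \<le> m" "m \<le> e" by (auto simp: e_def m_def)
    have div_mono: "N div e \<le> N div m" by (cases "m = 0") (use em in \<open>auto simp: m_def div_le_mono2\<close>)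
    have m_Suc: "N div (m + 1) \<le> N div m" by (rule div_le_mono2) (auto simp: m_def)
    have m_c: "N div m \<le> N div (c + 1)" by (rule div_le_mono2) (auto simp: m_def)
    have split: "R c (Suc k) x = R c k x + R m k x
        + (\<Sum>a\<in>{c<..m}. F x a) * (\<Sum>b\<in>{N div e<..N div m}. G x b)" for x
    proof -
      have "R c (Suc k) x = (\<Sum>a\<in>{c<..e}. F x a * (\<Sum>b\<in>{N div e<..N div a}. G x b))"
        by (simp add: R_def e_def)
      also have "{c<..e} = {c<..m} \<union> {m<..e}" using em by auto
      also have "(\<Sum>a\<in>{c<..m} \<union> {m<..e}. F x a * (\<Sum>b\<in>{N div e<..N div a}. G x b))
          = (\<Sum>a\<in>{c<..m}. F x a * (\<Sum>b\<in>{N div e<..N div a}. G x b))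
           + (\<Sum>a\<in>{m<..e}. F x a * (\<Sum>b\<in>{N div e<..N div a}. G x b))"
        by (rule sum.union_disjoint) auto
      also have "(\<Sum>a\<in>{m<..e}. F x a * (\<Sum>b\<in>{N div e<..N div a}. G x b)) = R m k x"
        by (simp add: R_def em)
      also have "(\<Sum>a\<in>{c<..m}. F x a * (\<Sum>b\<in>{N div e<..N div a}. G x b))
          = (\<Sum>a\<in>{c<..m}. F x a * (\<Sum>b\<in>{N div m<..N div a}. G x b)
              + F x a * (\<Sum>b\<in>{N div e<..N div m}. G x b))"
      proof (rule sum.cong)
        fix a assume a: "a \<in> {c<..m}"
        have "N div m \<le> N div a" using a by (intro div_le_mono2) auto
        hence "{N div e<..N div a} = {N div m<..N div a} \<union> {N div e<..N div m}"
          using div_mono by auto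
        hence "(\<Sum>b\<in>{N div e<..N div a}. G x b)
            = (\<Sum>b\<in>{N div m<..N div a}. G x b) + (\<Sum>b\<in>{N div e<..N div m}. G x b)"
          by (simp only:, subst sum.union_disjoint) auto
        thus "F x a * (\<Sum>b\<in>{N div e<..N div a}. G x b) = F x a * (\<Sum>b\<in>{N div m<..N div a}. G x b)
              + F x a * (\<Sum>b\<in>{N div e<..N div m}. G x b)"
          by (simp add: algebra_simps)
      qed simp
      also have "\<dots> = R c k x + (\<Sum>a\<in>{c<..m}. F x a) * (\<Sum>b\<in>{N div e<..N div m}. G x b)"
        by (simp add: R_def m_def sum.distrib sum_distrib_right)
      finally show ?thesis by simp
    qed
    have SUadd: "SU c m + SU m e = SU c e"
    proof -
      have "{c<..e} = {c<..m} \<union> {m<..e}" using em by auto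
      thus ?thesis unfolding SU_def by (simp only:, subst sum.union_disjoint) auto
    qed
    have SVadd: "SV (N div e) (N div m) + SV (N div m) (N div (c + 1)) = SV (N div e) (N div (c + 1))"
    proof -
      have "{N div e<..N div (c + 1)} = {N div e<..N div m} \<union> {N div m<..N div (c + 1)}"
        using div_mono m_c by auto
      thus ?thesis unfolding SV_def by (simp only:, subst sum.union_disjoint) auto
    qed
    let ?s = "sqrt (SU c e * SV (N div e) (N div (c + 1)))"
    have "(\<Sum>x\<in>X. norm (R c (Suc k) x)) \<le> (\<Sum>x\<in>X. norm (R c k x)) + (\<Sum>x\<in>X. norm (R m k x))
        + (\<Sum>x\<in>X. norm (\<Sum>a\<in>{c<..m}. F x a) * norm (\<Sum>b\<in>{N div e<..N div m}. G x b))"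
      unfolding split sum.distrib[symmetric]
      by (intro sum_mono) (metis (no_types, opaque_lifting) norm_mult norm_triangle_mono order_refl)
    also have "\<dots> \<le> K * k * sqrt (SU c m * SV (N div m) (N div (c + 1)))
        + K * k * sqrt (SU m e * SV (N div e) (N div m))
        + K * sqrt (SU c m * SV (N div e) (N div m))"
    proof (intro add_mono)
      show "(\<Sum>x\<in>X. norm (R c k x)) \<le> K * k * sqrt (SU c m * SV (N div m) (N div (c + 1)))"
        using Suc.IH[of c] by (simp add: m_def)
      have "(\<Sum>x\<in>X. norm (R m k x)) \<le> K * k * sqrt (SU m e * SV (N div e) (N div (m + 1)))"
        using Suc.IH[of m] by (simp add: em)
      also have "\<dots> \<le> K * k * sqrt (SU m e * SV (N div e) (N div m))"
        using K SU0 m_Suc by (intro mult_left_mono real_sqrt_le_mono SVmono) auto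
      finally show "(\<Sum>x\<in>X. norm (R m k x)) \<le> K * k * sqrt (SU m e * SV (N div e) (N div m))" .
      show "(\<Sum>x\<in>X. norm (\<Sum>a\<in>{c<..m}. F x a) * norm (\<Sum>b\<in>{N div e<..N div m}. G x b))
          \<le> K * sqrt (SU c m * SV (N div e) (N div m))"
        unfolding SU_def SV_def by (rule rect) (simp add: mult.commute)
    qed
    also have "\<dots> = K * k * (sqrt (SU c m * SV (N div m) (N div (c + 1))) + sqrt (SU m e * SV (N div e) (N div m)))
        + K * sqrt (SU c m * SV (N div e) (N div m))"
      by (simp add: algebra_simps)
    also have "\<dots> \<le> K * k * ?s + K * ?s"
    proof (intro add_mono mult_left_mono)
      show "sqrt (SU c m * SV (N div m) (N div (c + 1))) + sqrt (SU m e * SV (N div e) (N div m)) \<le> ?s"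
        using sqrt_mult_superadditive[OF SU0 SV0 SU0 SV0, of c m "N div m" "N div (c + 1)" m e "N div e" "N div m"]
        by (simp only: SUadd SVadd add.commute[of "SV (N div m) (N div (c + 1))"])
      have "SU c m * SV (N div e) (N div m) \<le> SU c e * SV (N div e) (N div (c + 1))"
        using SU0 SV0 SUadd SVadd by (intro mult_mono) (smt (verit))+
      thus "sqrt (SU c m * SV (N div e) (N div m)) \<le> ?s" by simp
    qed (use K in auto)
    also have "\<dots> = K * real (Suc k) * ?s" by (simp add: algebra_simps)
    finally show ?case by (simp add: e_def)
  qed
  have "R 0 k x = (\<Sum>a=1..N. F x a * (\<Sum>b=1..N div a. G x b))" for x
  proof -
    have "N div 2 ^ k = 0" using k by simp
    moreover have "{0<..j} = {1..j}" for j :: nat by auto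
    ultimately have "R 0 k x = (\<Sum>a=1..2^k. F x a * (\<Sum>b=1..N div a. G x b))"
      by (simp add: R_def)
    also have "\<dots> = (\<Sum>a=1..N. F x a * (\<Sum>b=1..N div a. G x b))"
      by (rule sum.mono_neutral_right) (use k in \<open>auto simp: div_less\<close>)
    finally show ?thesis .
  qed
  moreover have "SU 0 (0 + 2 ^ k) = (\<Sum>a=1..2^k. U a)" "SV (N div (0 + 2 ^ k)) (N div (0 + 1)) = (\<Sum>b=1..N. V b)"
    using k by (auto simp: SU_def SV_def intro!: sum.cong)
  ultimately show ?thesis using main[of 0 k] by simp
qed

lemma norm_completely_multiplicative_le_1:
  assumes h: "completely_multiplicative h" and p: "\<And>p. prime p \<Longrightarrow> norm (h p) \<le> 1" and "0 < n"
  shows "norm (h n) \<le> 1"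
  using \<open>0 < n\<close>
proof (induction n rule: less_induct)
  case (less n)
  show ?case
  proof (cases "n = 1")
    case True
    thus ?thesis using h by (simp add: completely_multiplicative_def)
  next
    case False
    then obtain p m where pm: "prime p" "n = p * m"
      using prime_factor_nat by (metis dvdE)
    have m: "0 < m" "m < n" using pm less.prems prime_gt_1_nat[of p] by (auto intro: Nat.gr0I)
    have "h n = h p * h m"
      using h pm m prime_gt_0_nat[of p] by (simp add: completely_multiplicative_def)
    thus ?thesis using p[OF pm(1)] less.IH[of m] m by (simp add: norm_mult mult_le_one)
  qed
qed

text \<open>Cauchy--Schwarz over the characters followed by Bessel bounds one rectangle by square roots of
  sums of \<open>4\<^sup>-\<^sup>\<Omega>\<close> and \<open>4\<^sup>-\<^sup>\<omega>\<close>.  Inserting \<open>m\<^sup>s a\<^sup>-\<^sup>s \<ge> 1\<close> and \<open>e\<^sup>s b\<^sup>-\<^sup>s \<ge> 1\<close> there, with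
  \<open>m\<close> and \<open>e\<close> the largest sides of the rectangle, costs only \<open>N\<^sup>s\<^sup>/\<^sup>2\<close> because \<open>m e \<le> N\<close>; the
  weights \<open>a\<^sup>-\<^sup>s\<close> are what makes the sums over all rectangles combine into Euler products.\<close>

lemma mean_abs_smooth_char_sum_le:
  fixes P :: "nat set" and s :: real
  assumes q: "0 < q" and N: "N \<le> q"
    and h: "completely_multiplicative h" and hp: "\<And>p. prime p \<Longrightarrow> norm (h p) \<le> 1"
    and k: "N < 2 ^ k" and s: "0 \<le> s"
  defines "A \<equiv> (\<Sum>a\<in>smooth_over P \<inter> {1..2^k}. (1/4) ^ big_omega a * real a powr - s)"
    and "B \<equiv> (\<Sum>b\<in>smooth_over P \<inter> {1..N}. (1/4) ^ small_omega b * real b powr - s)"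
  shows "(\<Sum>\<chi>\<in>dirichlet_chars q. norm (\<Sum>n\<in>smooth_over P \<inter> {1..N}. h n * \<chi> n))
           \<le> real (totient q) * (real N powr (s / 2) * real k * sqrt (A * B))"
proof -
  define f where "f a = (if a \<in> smooth_over P then (1/2) ^ big_omega a * h a else 0)" for a
  define g where "g b = (if b \<in> smooth_over P then (1/2) ^ small_omega b * h b else 0)" for b
  define U where "U a = (if a \<in> smooth_over P then (1/4) ^ big_omega a * real a powr - s else 0)" for a
  define V where "V b = (if b \<in> smooth_over P then (1/4) ^ small_omega b * real b powr - s else 0)" for b
  define X where "X = dirichlet_chars q"
  have chX: "dirichlet_char q \<chi>" if "\<chi> \<in> X" for \<chi> using that by (simp add: X_def dirichlet_chars_def)
  note h1 = norm_completely_multiplicative_le_1[OF h hp]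
  have U0: "U a \<ge> 0" and V0: "V a \<ge> 0" for a by (auto simp: U_def V_def)
  have pw: "((1/2) ^ j * t)\<^sup>2 \<le> (1/4) ^ j" if "0 \<le> t" "t \<le> 1" for t :: real and j
  proof -
    have "((1/2) ^ j * t)\<^sup>2 = (1/4) ^ j * t\<^sup>2"
      by (simp add: power_mult_distrib power2_eq_square flip: power_mult_distrib)
    also have "\<dots> \<le> (1/4) ^ j * 1"
      using that by (intro mult_left_mono) (auto simp: power_le_one)
    finally show ?thesis by simp
  qed
  have split_powr: "real m powr s * (c * real a powr - s) \<ge> c" if "0 < a" "a \<le> m" "0 \<le> c" for a m c
  proof -
    have "1 \<le> real m powr s * real a powr - s"
      using that s by (simp add: powr_minus field_simps powr_mono2)
    hence "c * 1 \<le> c * (real m powr s * real a powr - s)" using that by (intro mult_left_mono) auto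
    thus ?thesis by (simp add: mult_ac)
  qed
  have fU: "(norm (f a))\<^sup>2 \<le> real m powr s * U a" if "0 < a" "a \<le> m" for a m
  proof (cases "a \<in> smooth_over P")
    case True
    have "((1/2) ^ big_omega a * norm (h a))\<^sup>2 \<le> real m powr s * ((1/4) ^ big_omega a * real a powr - s)"
      by (rule order_trans[OF pw split_powr]) (use h1[of a] that in auto)
    thus ?thesis using True by (simp add: f_def U_def norm_mult norm_power)
  qed (simp add: f_def U_def)
  have gV: "(norm (g a))\<^sup>2 \<le> real m powr s * V a" if "0 < a" "a \<le> m" for a m
  proof (cases "a \<in> smooth_over P")
    case True
    have "((1/2) ^ small_omega a * norm (h a))\<^sup>2 \<le> real m powr s * ((1/4) ^ small_omega a * real a powr - s)"
      by (rule order_trans[OF pw split_powr]) (use h1[of a] that in auto)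
    thus ?thesis using True by (simp add: g_def V_def norm_mult norm_power)
  qed (simp add: g_def V_def)
  have conv: "(\<Sum>n\<in>smooth_over P \<inter> {1..N}. h n * \<chi> n)
      = (\<Sum>a=1..N. f a * \<chi> a * (\<Sum>b=1..N div a. g b * \<chi> b))" if \<chi>: "\<chi> \<in> X" for \<chi>
  proof -
    have inner: "(\<Sum>d | d dvd n. f d * g (n div d) * (\<chi> d * \<chi> (n div d))) = (if n \<in> smooth_over P then h n * \<chi> n else 0)"
      if "0 < n" for n
    proof -
      have "(\<Sum>d | d dvd n. f d * g (n div d) * (\<chi> d * \<chi> (n div d))) =
          (\<Sum>d | d dvd n. of_real ((1/2) ^ big_omega d * (1/2) ^ small_omega (n div d))
             * (if n \<in> smooth_over P then h n * \<chi> n else 0))"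
      proof (rule sum.cong, rule refl)
        fix d assume "d \<in> {d. d dvd n}"
        then obtain e where e: "n = d * e" by auto
        have de: "0 < d" "0 < e" "n div d = e" using e \<open>0 < n\<close> by auto
        have "n \<in> smooth_over P \<longleftrightarrow> d \<in> smooth_over P \<and> e \<in> smooth_over P"
          using smooth_over_mult_iff[OF de(1,2)] e by simp
        moreover have "h n = h d * h e" using h de e by (simp add: completely_multiplicative_def)
        moreover have "\<chi> n = \<chi> d * \<chi> e" using dirichlet_char_mult[OF chX[OF \<chi>]] e by simp
        ultimately show "f d * g (n div d) * (\<chi> d * \<chi> (n div d)) =
            of_real ((1/2) ^ big_omega d * (1/2) ^ small_omega (n div d))
             * (if n \<in> smooth_over P then h n * \<chi> n else 0)"
          by (auto simp: f_def g_def de(3))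
      qed
      also have "\<dots> = of_real (\<Sum>d | d dvd n. (1/2) ^ big_omega d * (1/2) ^ small_omega (n div d))
             * (if n \<in> smooth_over P then h n * \<chi> n else 0)"
        unfolding of_real_sum by (rule sum_distrib_right[symmetric])
      finally show ?thesis by (simp only: sum_divisors_half_powers[OF that]) simp
    qed
    have "(\<Sum>n\<in>smooth_over P \<inter> {1..N}. h n * \<chi> n) = (\<Sum>n=1..N. if n \<in> smooth_over P then h n * \<chi> n else 0)"
      by (simp add: sum.If_cases Int_commute)
    also have "\<dots> = (\<Sum>n=1..N. \<Sum>d | d dvd n. f d * g (n div d) * (\<chi> d * \<chi> (n div d)))"
      by (rule sum.cong) (auto simp: inner)
    also have "\<dots> = (\<Sum>a=1..N. \<Sum>b=1..N div a. f a * g b * (\<chi> a * \<chi> b))"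
      by (rule sum_divisors_eq_hyperbola)
    finally show ?thesis by (simp add: sum_distrib_left mult_ac)
  qed
  have bessel: "(\<Sum>\<chi>\<in>X. (norm (\<Sum>a\<in>{c<..m}. w a * \<chi> a))\<^sup>2) \<le> real (totient q) * (real m powr s * (\<Sum>a\<in>{c<..m}. W a))"
    if "m \<le> N" and wW: "\<And>a. 0 < a \<Longrightarrow> a \<le> m \<Longrightarrow> (norm (w a))\<^sup>2 \<le> real m powr s * W a" for w W c m
  proof -
    have "(\<Sum>\<chi>\<in>X. (norm (\<Sum>a\<in>{c<..m}. w a * \<chi> a))\<^sup>2) \<le> real (totient q) * (\<Sum>a\<in>{c<..m}. (norm (w a))\<^sup>2)"
      unfolding X_def by (rule dirichlet_char_bessel[OF q]) (use N that(1) in auto)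
    also have "\<dots> \<le> real (totient q) * (\<Sum>a\<in>{c<..m}. real m powr s * W a)"
      by (intro mult_left_mono sum_mono wW) auto
    finally show ?thesis by (simp add: sum_distrib_left)
  qed
  have rect: "(\<Sum>\<chi>\<in>X. norm (\<Sum>a\<in>{c<..m}. f a * \<chi> a) * norm (\<Sum>b\<in>{d<..e}. g b * \<chi> b))
        \<le> (real (totient q) * real N powr (s/2)) * sqrt ((\<Sum>a\<in>{c<..m}. U a) * (\<Sum>b\<in>{d<..e}. V b))"
    (is "?L \<le> ?K * sqrt (?U * ?V)")
    if me: "m * e \<le> N" for c m d e
  proof (cases "m = 0 \<or> e = 0")
    case True
    thus ?thesis by auto
  next
    case False
    have le: "m \<le> N" "e \<le> N" using me False by (auto intro: order_trans[rotated])
    have UV: "0 \<le> ?U" "0 \<le> ?V" by (auto intro: sum_nonneg U0 V0)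
    have "?L\<^sup>2 \<le> (\<Sum>\<chi>\<in>X. (norm (\<Sum>a\<in>{c<..m}. f a * \<chi> a))\<^sup>2) * (\<Sum>\<chi>\<in>X. (norm (\<Sum>b\<in>{d<..e}. g b * \<chi> b))\<^sup>2)"
      by (rule Cauchy_Schwarz_ineq_sum)
    also have "\<dots> \<le> (real (totient q) * (real m powr s * ?U)) * (real (totient q) * (real e powr s * ?V))"
      using le fU gV UV by (intro mult_mono bessel) (auto intro!: sum_nonneg mult_nonneg_nonneg)
    also have "\<dots> = (real (totient q))\<^sup>2 * (real (m * e) powr s * (?U * ?V))"
      by (simp add: powr_mult power2_eq_square mult_ac)
    also have "\<dots> \<le> (real (totient q))\<^sup>2 * (real N powr s * (?U * ?V))"
      using me UV s by (intro mult_left_mono mult_right_mono powr_mono2) (auto simp flip: of_nat_mult)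
    also have "\<dots> = (?K * sqrt (?U * ?V))\<^sup>2"
      using UV by (simp add: power_mult_distrib power2_eq_square[of "_ powr _"] flip: powr_add)
    finally show ?thesis
      by (rule power2_le_imp_le) (use UV in \<open>auto intro!: mult_nonneg_nonneg\<close>)
  qed
  have "(\<Sum>\<chi>\<in>X. norm (\<Sum>n\<in>smooth_over P \<inter> {1..N}. h n * \<chi> n))
      = (\<Sum>\<chi>\<in>X. norm (\<Sum>a=1..N. f a * \<chi> a * (\<Sum>b=1..N div a. g b * \<chi> b)))"
    by (intro sum.cong refl arg_cong[of _ _ norm] conv)
  also have "\<dots> \<le> (real (totient q) * real N powr (s/2)) * k * sqrt ((\<Sum>a=1..2^k. U a) * (\<Sum>b=1..N. V b))"
    by (rule dyadic_hyperbola_bound[OF U0 V0 _ rect k]) auto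
  also have "(\<Sum>a=1..2^k. U a) = A"
    by (simp add: A_def U_def sum.If_cases Int_commute)
  also have "(\<Sum>b=1..N. V b) = B"
    by (simp add: B_def V_def sum.If_cases Int_commute)
  finally show ?thesis by (simp add: X_def mult_ac)
qed

section \<open>Chebyshev and Mertens estimates\<close>

definition primes_le :: "real \<Rightarrow> nat set" where
  "primes_le z = {p. prime p \<and> real p \<le> z}"

lemma finite_primes_le [simp]: "finite (primes_le z)"
  by (rule finite_subset[of _ "{..nat \<lfloor>z\<rfloor>}"]) (auto simp: primes_le_def le_nat_iff le_floor_iff)

lemma primes_le_of_nat: "primes_le (real n) = {p. prime p \<and> p \<le> n}"
  by (simp add: primes_le_def)

lemma primes_le_floor: "0 \<le> z \<Longrightarrow> primes_le z = primes_le (real (nat \<lfloor>z\<rfloor>))"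
proof -
  assume "0 \<le> z"
  hence "real p \<le> z \<longleftrightarrow> p \<le> nat \<lfloor>z\<rfloor>" for p by (simp add: le_nat_iff le_floor_iff)
  thus ?thesis by (simp add: primes_le_def)
qed

lemma primes_le_mono: "z \<le> z' \<Longrightarrow> primes_le z \<subseteq> primes_le z'"
  by (auto simp: primes_le_def)

lemma primes_le_gt_1: "p \<in> primes_le z \<Longrightarrow> 1 < real p"
  using prime_gt_1_nat by (auto simp: primes_le_def)

lemma primes_le_ge_2: "p \<in> primes_le z \<Longrightarrow> 2 \<le> real p"
  using prime_ge_2_nat by (auto simp: primes_le_def)

lemma prod_distinct_primes_dvd:
  fixes n :: nat
  assumes "finite A" "\<And>p. p \<in> A \<Longrightarrow> prime p \<and> p dvd n"
  shows "\<Prod>A dvd n"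
  using assms
proof (induction A rule: finite_induct)
  case (insert p A)
  have "coprime p (\<Prod>A)"
    using insert by (intro prod_coprime_right primes_coprime) auto
  thus ?case using insert by (auto intro: divides_mult)
qed simp

definition theta :: "real \<Rightarrow> real" where
  "theta z = (\<Sum>p\<in>primes_le z. ln (real p))"

lemma theta_nonneg: "theta z \<ge> 0"
  unfolding theta_def using primes_le_gt_1 by (intro sum_nonneg ln_ge_zero) (auto intro: less_imp_le)

text \<open>The primes in \<open>(n - n div 2, n]\<close> all divide the central binomial coefficient, which is at most
  \<open>2 ^ n\<close>; the constant absorbs the rounding in the induction.\<close>

lemma theta_upper_nat: "theta (real n) \<le> 3 * ln 2 * real n"
proof (induction n rule: less_induct)
  case (less n)
  show ?case
  proof (cases "n < 2")
    case True
    have "primes_le (real n) = {}" using True by (auto simp: primes_le_def dest!: prime_ge_2_nat)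
    thus ?thesis by (simp add: theta_def)
  next
    case False
    define m r where "m = n div 2" and "r = n - m"
    have mr: "m \<le> r" "m + r = n" "r < n" "n \<le> 3 * m" using False by (auto simp: m_def r_def)
    define A where "A = {p. prime p \<and> r < p \<and> p \<le> n}"
    have finA: "finite A" by (auto simp: A_def)
    have "\<Prod>A dvd (n choose m)"
    proof (rule prod_distinct_primes_dvd[OF finA])
      fix p assume p: "p \<in> A"
      have "fact n = fact m * fact r * (n choose m)"
        unfolding r_def by (rule binomial_fact_lemma[symmetric]) (simp add: m_def)
      moreover have "p dvd fact n" using p by (auto simp: A_def prime_dvd_fact_iff)
      moreover have "\<not> p dvd fact m" "\<not> p dvd fact r" using p mr by (auto simp: A_def prime_dvd_fact_iff)
      ultimately show "prime p \<and> p dvd (n choose m)"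
        using p by (auto simp: A_def prime_dvd_mult_iff)
    qed
    hence "\<Prod>A \<le> (n choose m)" using mr by (intro dvd_imp_le) auto
    also have "\<dots> \<le> 2 ^ n" by (rule binomial_le_pow2)
    finally have "real (\<Prod>A) \<le> 2 ^ n" by (metis of_nat_le_iff of_nat_numeral of_nat_power)
    moreover have pos: "0 < real (\<Prod>A)" by (auto simp: A_def prime_gt_0_nat intro!: prod_pos)
    ultimately have "ln (real (\<Prod>A)) \<le> ln (2 ^ n)" by simp
    moreover have "ln (real (\<Prod>A)) = (\<Sum>p\<in>A. ln (real p))"
      unfolding of_nat_prod by (rule ln_prod[OF finA]) (auto simp: A_def prime_gt_0_nat)
    ultimately have "(\<Sum>p\<in>A. ln (real p)) \<le> real n * ln 2" by (simp add: ln_realpow)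
    moreover have "theta (real n) = theta (real r) + (\<Sum>p\<in>A. ln (real p))"
    proof -
      have "primes_le (real n) = primes_le (real r) \<union> A" "primes_le (real r) \<inter> A = {}"
        using mr(3) by (auto simp: primes_le_of_nat A_def)
      thus ?thesis unfolding theta_def using finA by (simp add: sum.union_disjoint)
    qed
    moreover have "theta (real r) \<le> 3 * ln 2 * real r" by (rule less.IH[OF mr(3)])
    moreover have "ln 2 * real n \<le> ln 2 * (3 * real m)" using mr(4) by (intro mult_left_mono) auto
    moreover have "3 * ln 2 * real n = ln 2 * (3 * real m) + 3 * ln 2 * real r"
      unfolding mr(2)[symmetric] by (simp only: of_nat_add) (simp only: algebra_simps)
    moreover have "ln 2 * real n = real n * ln 2" by simp
    ultimately show ?thesis by linarith
  qed
qed

lemma card_multiples: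
  assumes "0 < d"
  shows "card {m\<in>{1..n}. d dvd m} = n div (d::nat)"
proof -
  have "{m\<in>{1..n}. d dvd m} = (\<lambda>j. d * j) ` {1..n div d}"
  proof (intro equalityI subsetI)
    fix m assume "m \<in> {m\<in>{1..n}. d dvd m}"
    then obtain j where j: "m = d * j" "1 \<le> m" "m \<le> n" by auto
    hence "1 \<le> j" by (cases j) auto
    moreover have "j \<le> n div d" using j assms by (simp add: less_eq_div_iff_mult_less_eq mult.commute)
    ultimately show "m \<in> (\<lambda>j. d * j) ` {1..n div d}" using j by auto
  next
    fix m assume "m \<in> (\<lambda>j. d * j) ` {1..n div d}"
    thus "m \<in> {m\<in>{1..n}. d dvd m}" using assms
      by (auto simp: less_eq_div_iff_mult_less_eq mult.commute Suc_le_eq)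
  qed
  moreover have "inj_on (\<lambda>j. d * j) {1..n div d}" using assms by (auto intro: inj_onI)
  ultimately show ?thesis by (simp add: card_image)
qed

lemma real_div_minus_one_le:
  assumes "0 < d"
  shows "real n / real d - 1 \<le> real (n div d)"
proof -
  have "n = n div d * d + n mod d" by simp
  also have "\<dots> < n div d * d + d" by (rule add_strict_left_mono) (use assms in simp)
  finally have "n < (n div d + 1) * d" by simp
  hence "real n < (real (n div d) + 1) * real d"
    by (metis of_nat_less_iff of_nat_mult of_nat_add of_nat_1)
  thus ?thesis using assms by (simp add: field_simps)
qed

text \<open>Bounds for the exponent of \<open>p\<close> in \<open>n!\<close>, read off from Legendre's formula.\<close>

lemma sum_multiplicity_bounds:
  fixes p n :: nat
  assumes p: "prime p"
  shows "real n / real p - 1 \<le> real (\<Sum>m=1..n. multiplicity p m)"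
    and "real (\<Sum>m=1..n. multiplicity p m) \<le> real n / (real p - 1)"
proof -
  have p1: "1 < real p" using prime_gt_1_nat[OF p] by simp
  have mult_card: "multiplicity p m = card {k\<in>{1..n}. p ^ k dvd m}" if m: "m \<in> {1..n}" for m
  proof -
    have iff: "p ^ k dvd m \<longleftrightarrow> k \<le> multiplicity p m" for k
      using m p by (intro power_dvd_iff_le_multiplicity) auto
    have "multiplicity p m < 2 ^ multiplicity p m" by (rule less_exp)
    also have "\<dots> \<le> p ^ multiplicity p m" using prime_ge_2_nat[OF p] by (rule power_mono) simp
    also have "\<dots> \<le> m" using m by (intro dvd_imp_le multiplicity_dvd) auto
    finally have "{k\<in>{1..n}. p ^ k dvd m} = {1..multiplicity p m}" using m by (auto simp: iff)
    thus ?thesis by simp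
  qed
  have "(\<Sum>m=1..n. multiplicity p m) = (\<Sum>m=1..n. \<Sum>k=1..n. if p ^ k dvd m then 1 else 0)"
    by (intro sum.cong refl) (simp add: mult_card sum.If_cases Int_def)
  also have "\<dots> = (\<Sum>k=1..n. \<Sum>m=1..n. if p ^ k dvd m then 1 else 0)"
    by (rule sum.swap)
  also have "\<dots> = (\<Sum>k=1..n. n div p ^ k)"
    using card_multiples[of "p ^ _" n] prime_gt_0_nat[OF p]
    by (intro sum.cong refl) (simp add: sum.If_cases Int_def)
  finally have eq: "(\<Sum>m=1..n. multiplicity p m) = (\<Sum>k=1..n. n div p ^ k)" .
  have "(\<Sum>k=1..n. real (n div p ^ k)) \<le> (\<Sum>k=1..n. real n * (1 / real p) ^ k)"
  proof (rule sum_mono)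
    fix k
    have "real (n div p ^ k) \<le> real n / real (p ^ k)" by (rule of_nat_div_le_of_nat)
    thus "real (n div p ^ k) \<le> real n * (1 / real p) ^ k" by (simp add: power_one_over)
  qed
  also have "\<dots> = real n * (\<Sum>k=1..n. (1 / real p) ^ k)" by (simp add: sum_distrib_left)
  also have "(\<Sum>k=1..n. (1 / real p) ^ k) = (1 - (1 / real p) ^ n) / (real p - 1)"
  proof (induction n)
    case (Suc n)
    have "(1 - (1 / real p) ^ n) / (real p - 1) + (1 / real p) ^ Suc n = (1 - (1 / real p) ^ Suc n) / (real p - 1)"
      using p1 by (simp add: divide_simps) (simp add: algebra_simps)
    thus ?case using Suc by simp
  qed simp
  also have "real n * \<dots> \<le> real n * (1 / (real p - 1))"
    using p1 by (intro mult_left_mono divide_right_mono) auto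
  finally show "real (\<Sum>m=1..n. multiplicity p m) \<le> real n / (real p - 1)" unfolding eq by simp
  show "real n / real p - 1 \<le> real (\<Sum>m=1..n. multiplicity p m)"
  proof (cases "n = 0")
    case False
    have "real n / real p - 1 \<le> real (n div p)"
      using real_div_minus_one_le[OF prime_gt_0_nat[OF p]] .
    also have "n div p ^ 1 \<le> (\<Sum>k=1..n. n div p ^ k)"
      by (rule member_le_sum) (use False in auto)
    hence "real (n div p) \<le> real (\<Sum>k=1..n. n div p ^ k)"
      by (simp only: power_one_right of_nat_le_iff)
    finally show ?thesis unfolding eq .
  qed simp
qed

lemma ln_fact_eq_sum_primes:
  "ln (fact n :: real) = (\<Sum>p\<in>primes_le (real n). ln (real p) * real (\<Sum>m=1..n. multiplicity p m))"
proof -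
  have lnm: "ln (real m) = (\<Sum>p\<in>primes_le (real n). real (multiplicity p m) * ln (real p))"
    if m: "m \<in> {1..n}" for m
  proof -
    have "0 < m" using m by simp
    from prime_factorization_nat[OF this]
    have "real m = real (\<Prod>p\<in>prime_factors m. p ^ multiplicity p m)"
      by (rule arg_cong)
    also have "\<dots> = (\<Prod>p\<in>prime_factors m. real p ^ multiplicity p m)" by simp
    finally have "ln (real m) = ln (\<Prod>p\<in>prime_factors m. real p ^ multiplicity p m)"
      by (rule arg_cong)
    also have "\<dots> = (\<Sum>p\<in>prime_factors m. ln (real p ^ multiplicity p m))"
      by (rule ln_prod) (auto simp: prime_gt_0_nat in_prime_factors_imp_prime)
    also have "\<dots> = (\<Sum>p\<in>prime_factors m. real (multiplicity p m) * ln (real p))"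
      by (intro sum.cong refl ln_realpow)
    also have "\<dots> = (\<Sum>p\<in>primes_le (real n). real (multiplicity p m) * ln (real p))"
    proof (rule sum.mono_neutral_left)
      show "prime_factors m \<subseteq> primes_le (real n)"
        using m by (auto simp: primes_le_of_nat prime_factors_dvd dest!: dvd_imp_le)
      show "\<forall>p\<in>primes_le (real n) - prime_factors m. real (multiplicity p m) * ln (real p) = 0"
        using m by (auto simp: primes_le_of_nat prime_factors_dvd not_dvd_imp_multiplicity_0)
    qed simp
    finally show ?thesis .
  qed
  have "ln (fact n :: real) = ln (\<Prod>m=1..n. real m)" by (simp add: fact_prod)
  also have "\<dots> = (\<Sum>m=1..n. ln (real m))" by (rule ln_prod) auto
  also have "\<dots> = (\<Sum>m=1..n. \<Sum>p\<in>primes_le (real n). real (multiplicity p m) * ln (real p))"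
    by (intro sum.cong refl lnm)
  also have "\<dots> = (\<Sum>p\<in>primes_le (real n). \<Sum>m=1..n. real (multiplicity p m) * ln (real p))"
    by (rule sum.swap)
  finally show ?thesis by (simp add: sum_distrib_left sum_distrib_right mult.commute)
qed

lemma ln_fact_bounds:
  assumes "0 < n"
  shows "real n * ln (real n) - real n \<le> ln (fact n :: real)" "ln (fact n :: real) \<le> real n * ln (real n)"
proof -
  show "real n * ln (real n) - real n \<le> ln (fact n :: real)"
    using assms
  proof (induction n rule: nat_induct_non_zero)
    case 1
    thus ?case by simp
  next
    case (Suc n)
    have "real n * ln (real (Suc n) / real n) \<le> real n * (real (Suc n) / real n - 1)"
      using Suc by (intro mult_left_mono ln_le_minus_one) auto
    also have "\<dots> = 1" using Suc by (simp add: field_simps)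
    finally have "real n * ln (real (Suc n)) \<le> real n * ln (real n) + 1"
      using Suc by (simp add: ln_div algebra_simps)
    moreover have "ln (fact (Suc n) :: real) = ln (real (Suc n)) + ln (fact n)"
      by (simp add: ln_mult del: of_nat_Suc)
    ultimately show ?case using Suc.IH by (simp add: algebra_simps)
  qed
  have "(fact n :: real) \<le> of_nat (n ^ n)" by (rule fact_le_power)
  hence "(fact n :: real) \<le> real n ^ n" by simp
  hence "ln (fact n :: real) \<le> ln (real n ^ n)" using assms by (subst ln_le_cancel_iff) auto
  thus "ln (fact n :: real) \<le> real n * ln (real n)" using assms by (simp add: ln_realpow)
qed

text \<open>The difference between \<open>log p / (p - 1)\<close> and \<open>log p / p\<close>, summed; the sum over all integers
  telescopes against \<open>(log k + 2) / k\<close>.\<close>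

lemma sum_ln_over_consecutive_le_2:
  "(\<Sum>p\<in>primes_le (real n). ln (real p) / (real p * (real p - 1))) \<le> 2"
proof -
  define g where "g k = (ln (real k) + 2) / real k" for k
  have step: "ln (real (Suc k)) / (real (Suc k) * real k) \<le> g k - g (Suc k)" if k: "0 < k" for k
  proof -
    have "ln (real (Suc k) / real k) \<le> real (Suc k) / real k - 1" using k by (intro ln_le_minus_one) auto
    hence l: "ln (real (Suc k)) - ln (real k) \<le> 1 / real k" using k by (simp add: ln_div field_simps)
    hence "real k * (ln (real (Suc k)) - ln (real k)) \<le> 1" using k by (simp add: field_simps)
    moreover have "1 / real k \<le> 1" using k by simp
    ultimately have "ln (real (Suc k)) \<le> (real k + 1) * (ln (real k) + 2) - real k * (ln (real (Suc k)) + 2)"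
      using l by (simp add: algebra_simps del: of_nat_Suc)
    hence "ln (real (Suc k)) / (real (Suc k) * real k) \<le>
        ((real k + 1) * (ln (real k) + 2) - real k * (ln (real (Suc k)) + 2)) / (real (Suc k) * real k)"
      using k by (intro divide_right_mono) auto
    also have "\<dots> = g k - g (Suc k)" using k by (simp add: g_def field_simps del: of_nat_Suc) (simp add: algebra_simps)
    finally show ?thesis .
  qed
  have tele: "(\<Sum>k=1..n. ln (real (Suc k)) / (real (Suc k) * real k)) \<le> 2 - g (Suc n)" for n
  proof (induction n)
    case 0
    show ?case by (simp add: g_def)
  next
    case (Suc n)
    thus ?case using step[of "Suc n"] by simp
  qed
  have g0: "g (Suc n) \<ge> 0" for n by (simp add: g_def)
  have rng: "2 \<le> p \<and> p \<le> n" if "p \<in> primes_le (real n)" for p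
    using that by (simp add: primes_le_of_nat prime_ge_2_nat)
  have inj: "inj_on (\<lambda>p. p - 1) (primes_le (real n))"
    by (rule inj_on_diff_nat) (use rng in force)
  have "(\<Sum>p\<in>primes_le (real n). ln (real p) / (real p * (real p - 1)))
      = (\<Sum>k\<in>(\<lambda>p. p - 1) ` primes_le (real n). ln (real (Suc k)) / (real (Suc k) * real k))"
    by (subst sum.reindex[OF inj], rule sum.cong) (use rng in \<open>force simp: o_def of_nat_diff\<close>)+
  also have "\<dots> \<le> (\<Sum>k=1..n. ln (real (Suc k)) / (real (Suc k) * real k))"
    by (rule sum_mono2) (use rng in force)+
  finally show ?thesis using tele[of n] g0[of n] by linarith
qed

definition mertens :: "real \<Rightarrow> real" where
  "mertens z = (\<Sum>p\<in>primes_le z. ln (real p) / real p)"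

text \<open>Stirling's formula for \<open>log n!\<close> compared with its expansion over primes.  Replacing
  \<open>\<lfloor>n/p\<rfloor>\<close> by \<open>n/p\<close> costs \<open>theta n = O(n)\<close> from above, and from below the higher prime powers cost a
  convergent sum.\<close>

lemma mertens_bounds:
  assumes "1 \<le> z"
  shows "ln z - 4 \<le> mertens z" "mertens z \<le> ln z + 4"
proof -
  define n where "n = nat \<lfloor>z\<rfloor>"
  have n: "0 < n" "real n \<le> z" "z < real n + 1" using assms by (auto simp: n_def)
  have P: "primes_le z = primes_le (real n)" unfolding n_def by (rule primes_le_floor) (use assms in simp)
  have ln0: "0 \<le> ln (real p)" if "p \<in> primes_le (real n)" for p using primes_le_gt_1[OF that] by simp
  have pr: "prime p" if "p \<in> primes_le (real n)" for p using that by (simp add: primes_le_def)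
  have "real n * mertens z - theta (real n) = (\<Sum>p\<in>primes_le (real n). ln (real p) * (real n / real p - 1))"
    unfolding mertens_def theta_def P sum_distrib_left sum_subtractf[symmetric]
    by (intro sum.cong refl) (simp add: right_diff_distrib)
  also have "\<dots> \<le> ln (fact n :: real)"
    unfolding ln_fact_eq_sum_primes
    by (intro sum_mono mult_left_mono sum_multiplicity_bounds ln0 pr)
  also have "\<dots> \<le> real n * ln (real n)" by (rule ln_fact_bounds) (use n in auto)
  finally have "real n * mertens z \<le> real n * (ln (real n) + 3 * ln 2)"
    using theta_upper_nat[of n] by (simp add: algebra_simps)
  hence "mertens z \<le> ln (real n) + 3 * ln 2" using n by simp
  moreover have "ln (real n) \<le> ln z" using n by simp
  moreover have ln2: "ln 2 \<le> (1::real)" using ln_le_minus_one[of 2] by simp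
  ultimately show "mertens z \<le> ln z + 4" by linarith
  have "real n * ln (real n) - real n \<le> ln (fact n :: real)" by (rule ln_fact_bounds) (use n in auto)
  also have "\<dots> \<le> (\<Sum>p\<in>primes_le (real n). ln (real p) * (real n / (real p - 1)))"
    unfolding ln_fact_eq_sum_primes
    by (intro sum_mono mult_left_mono sum_multiplicity_bounds ln0 pr)
  also have "\<dots> = real n * (\<Sum>p\<in>primes_le (real n). ln (real p) / (real p - 1))"
    by (simp add: sum_distrib_left mult_ac)
  finally have "real n * (ln (real n) - 1) \<le> real n * (\<Sum>p\<in>primes_le (real n). ln (real p) / (real p - 1))"
    by (simp add: algebra_simps)
  hence "ln (real n) - 1 \<le> (\<Sum>p\<in>primes_le (real n). ln (real p) / (real p - 1))" using n by simp
  also have "\<dots> = mertens z + (\<Sum>p\<in>primes_le (real n). ln (real p) / (real p * (real p - 1)))"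
    unfolding mertens_def P sum.distrib[symmetric]
  proof (rule sum.cong)
    fix p assume "p \<in> primes_le (real n)"
    hence "1 < real p" by (rule primes_le_gt_1)
    thus "ln (real p) / (real p - 1) = ln (real p) / real p + ln (real p) / (real p * (real p - 1))"
      by (simp add: divide_simps) (simp add: algebra_simps)
  qed simp
  finally have "ln (real n) - 3 \<le> mertens z" using sum_ln_over_consecutive_le_2[of n] by linarith
  moreover have "ln z \<le> ln (2 * real n)"
  proof -
    have "1 \<le> real n" using n(1) by simp
    hence "z \<le> 2 * real n" using n(3) by linarith
    thus ?thesis using assms by simp
  qed
  moreover have "ln (2 * real n) = ln 2 + ln (real n)" using n by (simp add: ln_mult)
  ultimately show "ln z - 4 \<le> mertens z" using ln2 by linarith
qed

text \<open>Since Mertens' sum determines \<open>ln z\<close> up to an error \<open>4\<close>, it grows by at least one between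
  \<open>z / exp 9\<close> and \<open>z\<close>, and each prime \<open>p\<close> in this range contributes to that growth at most
  \<open>exp 9 / z\<close> times \<open>ln p\<close>.  The term \<open>-1\<close> makes the bound hold down to \<open>z = 0\<close>.\<close>

lemma theta_lower:
  assumes "0 \<le> z"
  shows "z / exp 9 - 1 \<le> theta z"
proof (cases "z < exp 9")
  case True
  hence "z / exp 9 - 1 \<le> 0" by simp
  thus ?thesis using theta_nonneg[of z] by linarith
next
  case False
  define w where "w = z / exp 9"
  have z: "exp 9 \<le> z" "0 < z" "1 \<le> w" "w \<le> z"
    using False assms less_le_trans[OF exp_gt_zero[of 9]] by (auto simp: w_def field_simps)
  have "1 \<le> z" using z by linarith
  have "1 \<le> mertens z - mertens w"
    using mertens_bounds(1)[OF \<open>1 \<le> z\<close>] mertens_bounds(2)[OF z(3)] z by (simp add: w_def ln_div)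
  also have "mertens z - mertens w = (\<Sum>p\<in>primes_le z - primes_le w. ln (real p) / real p)"
    unfolding mertens_def using primes_le_mono[OF z(4)] by (intro sum_diff[symmetric]) auto
  also have "\<dots> \<le> (\<Sum>p\<in>primes_le z - primes_le w. ln (real p) / w)"
    using z primes_le_gt_1[of _ z]
    by (intro sum_mono divide_left_mono) (force simp: primes_le_def)+
  also have "\<dots> \<le> (\<Sum>p\<in>primes_le z. ln (real p) / w)"
    using z primes_le_gt_1[of _ z] by (intro sum_mono2) (auto intro!: divide_nonneg_pos ln_ge_zero intro: less_imp_le)
  also have "\<dots> = theta z / w" by (simp add: theta_def sum_divide_distrib)
  finally have "w \<le> theta z" using z by (simp add: field_simps)
  thus ?thesis by (simp add: w_def)
qed

section \<open>Rankin weights on smooth numbers\<close>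

definition euler_product :: "nat set \<Rightarrow> real \<Rightarrow> real" where
  "euler_product P s = (\<Prod>p\<in>P. 1 / (1 - real p powr - s))"

lemma powr_neg_prime_bounds:
  assumes "prime (p :: nat)" "0 < s"
  shows "0 < real p powr - s" "real p powr - s < 1"
proof -
  have "1 < real p" using prime_gt_1_nat[OF assms(1)] by simp
  thus "0 < real p powr - s" "real p powr - s < 1"
    using assms(2) by (auto simp: powr_minus field_simps)
qed

lemma powr_mult_prime_power:
  "real (m * p ^ k) powr - s = real m powr - s * (real p powr - s) ^ k"
proof -
  have "real (p ^ k) powr - s = (real p powr - s) ^ k"
    by (induction k) (simp_all add: powr_mult)
  thus ?thesis by (simp add: powr_mult)
qed

lemma has_sum_geometric_powers:
  fixes X :: real
  assumes "0 \<le> X" "X < 1"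
  shows "((\<lambda>k. X ^ k) has_sum (1 / (1 - X))) UNIV"
  by (rule sums_nonneg_imp_has_sum) (use geometric_sums[of X] assms in auto)

lemma has_sum_euler_product:
  assumes "finite P" "\<And>p. p \<in> P \<Longrightarrow> prime p" "0 < s"
  shows "((\<lambda>n. real n powr - s) has_sum euler_product P s) (smooth_over P)"
  unfolding euler_product_def
proof (rule has_sum_smooth_over[where g = "\<lambda>p k. (real p powr - s) ^ k"])
  show "((\<lambda>k. (real p powr - s) ^ k) has_sum 1 / (1 - real p powr - s)) UNIV" if "p \<in> P" for p
    using powr_neg_prime_bounds[OF assms(2)[OF that] assms(3)] by (intro has_sum_geometric_powers) auto
  show "real (m * p ^ k) powr - s = real m powr - s * (real p powr - s) ^ k" for p m k
    by (rule powr_mult_prime_power)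
qed (use assms in auto)

lemma has_sum_quarter_big_omega:
  assumes "finite P" "\<And>p. p \<in> P \<Longrightarrow> prime p" "0 < s"
  shows "((\<lambda>n. (1/4) ^ big_omega n * real n powr - s) has_sum (\<Prod>p\<in>P. 1 / (1 - real p powr - s / 4)))
           (smooth_over P)"
proof (rule has_sum_smooth_over[where g = "\<lambda>p k. (real p powr - s / 4) ^ k"])
  show "((\<lambda>k. (real p powr - s / 4) ^ k) has_sum 1 / (1 - real p powr - s / 4)) UNIV" if "p \<in> P" for p
    using powr_neg_prime_bounds[OF assms(2)[OF that] assms(3)] by (intro has_sum_geometric_powers) auto
  show "(1/4) ^ big_omega (m * p ^ k) * real (m * p ^ k) powr - s
      = ((1/4) ^ big_omega m * real m powr - s) * (real p powr - s / 4) ^ k" if "p \<in> P" "0 < m" for p m k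
    using that assms by (simp only: big_omega_mult_prime_power powr_mult_prime_power)
      (simp add: power_add power_divide)
qed (use assms in \<open>auto simp: big_omega_def\<close>)

lemma has_sum_quarter_small_omega:
  assumes "finite P" "\<And>p. p \<in> P \<Longrightarrow> prime p" "0 < s"
  shows "((\<lambda>n. (1/4) ^ small_omega n * real n powr - s) has_sum
            (\<Prod>p\<in>P. (1 - 3/4 * real p powr - s) / (1 - real p powr - s))) (smooth_over P)"
proof (rule has_sum_smooth_over[where g = "\<lambda>p k. (if k = 0 then 1 else 1/4) * (real p powr - s) ^ k"])
  fix p assume p: "p \<in> P"
  define X where "X = real p powr - s"
  have X: "0 < X" "X < 1" using powr_neg_prime_bounds[OF assms(2)[OF p] assms(3)] by (auto simp: X_def)
  \<comment> \<open>The weight is \<open>1/4\<close> at every exponent, plus \<open>3/4\<close> at exponent zero, where \<open>\<omega>\<close> vanishes.\<close>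
  have "((\<lambda>k. 1/4 * X ^ k) has_sum 1/4 * (1 / (1 - X))) UNIV"
    by (intro has_sum_cmult_right has_sum_geometric_powers) (use X in auto)
  moreover have "((\<lambda>k::nat. if k = 0 then 3/4 else (0::real)) has_sum 3/4) UNIV"
    by (rule has_sum_finite_neutralI[of "{0}"]) auto
  ultimately have "((\<lambda>k. 1/4 * X ^ k + (if k = 0 then 3/4 else 0)) has_sum (1/4 * (1 / (1 - X)) + 3/4)) UNIV"
    by (rule has_sum_add)
  also have "(\<lambda>k. 1/4 * X ^ k + (if k = 0 then 3/4 else 0)) = (\<lambda>k. (if k = 0 then 1 else 1/4) * X ^ k)"
    by auto
  also have "1/4 * (1 / (1 - X)) + 3/4 = (1 - 3/4 * X) / (1 - X)"
    using X by (simp add: field_simps)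
  finally show "((\<lambda>k. (if k = 0 then 1 else 1/4) * (real p powr - s) ^ k) has_sum
      (1 - 3/4 * real p powr - s) / (1 - real p powr - s)) UNIV"
    by (simp only: X_def)
next
  show "(1/4) ^ small_omega (m * p ^ k) * real (m * p ^ k) powr - s
      = ((1/4) ^ small_omega m * real m powr - s) * ((if k = 0 then 1 else 1/4) * (real p powr - s) ^ k)"
    if "p \<in> P" "0 < m" "\<not> p dvd m" for p m k
    by (simp only: small_omega_mult_prime_power[OF assms(2)[OF that(1)] that(2,3)] powr_mult_prime_power)
      (simp add: power_add)
qed (use assms in \<open>auto simp: small_omega_def\<close>)

text \<open>Per prime, with \<open>X = p\<^sup>-\<^sup>s\<close>, the two Euler factors multiply to \<open>1 / (1 - X)\<close> times
  \<open>(1 - 3X/4) / (1 - X/4) \<le> 1 - X/2\<close>.  This is the whole saving over the second moment.\<close>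

lemma square_root_weights_le:
  assumes P: "finite P" "\<And>p. p \<in> P \<Longrightarrow> prime p" and s: "0 < s"
    and I: "finite I" "I \<subseteq> smooth_over P" and J: "finite J" "J \<subseteq> smooth_over P"
  shows "(\<Sum>a\<in>I. (1/4) ^ big_omega a * real a powr - s) * (\<Sum>b\<in>J. (1/4) ^ small_omega b * real b powr - s)
           \<le> euler_product P s * exp (- (\<Sum>p\<in>P. real p powr - s) / 2)"
proof -
  note X = powr_neg_prime_bounds[OF P(2) s]
  have "(\<Sum>a\<in>I. (1/4) ^ big_omega a * real a powr - s) \<le> (\<Prod>p\<in>P. 1 / (1 - real p powr - s / 4))"
    by (rule finite_sum_le_has_sum[OF has_sum_quarter_big_omega[OF P s]]) (use I in auto)
  moreover have "(\<Sum>b\<in>J. (1/4) ^ small_omega b * real b powr - s)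
      \<le> (\<Prod>p\<in>P. (1 - 3/4 * real p powr - s) / (1 - real p powr - s))"
    by (rule finite_sum_le_has_sum[OF has_sum_quarter_small_omega[OF P s]]) (use J in auto)
  ultimately have "(\<Sum>a\<in>I. (1/4) ^ big_omega a * real a powr - s) * (\<Sum>b\<in>J. (1/4) ^ small_omega b * real b powr - s)
      \<le> (\<Prod>p\<in>P. 1 / (1 - real p powr - s / 4)) * (\<Prod>p\<in>P. (1 - 3/4 * real p powr - s) / (1 - real p powr - s))"
  proof (rule mult_mono)
    show "0 \<le> (\<Prod>p\<in>P. 1 / (1 - real p powr - s / 4))"
    proof (rule prod_nonneg)
      fix p assume "p \<in> P"
      thus "0 \<le> 1 / (1 - real p powr - s / 4)" using X(1,2)[of p] by simp
    qed
  qed (auto intro: sum_nonneg)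
  also have "\<dots> = (\<Prod>p\<in>P. 1 / (1 - real p powr - s / 4) * ((1 - 3/4 * real p powr - s) / (1 - real p powr - s)))"
    by (rule prod.distrib[symmetric])
  also have "\<dots> \<le> (\<Prod>p\<in>P. 1 / (1 - real p powr - s) * exp (- (real p powr - s) / 2))"
  proof (rule prod_mono)
    fix p assume p: "p \<in> P"
    define x where "x = real p powr - s"
    have x: "0 < x" "x < 1" using X[OF p] by (auto simp: x_def)
    have "1 - 3/4 * x \<le> (1 - x / 2) * (1 - x / 4)" using x by (simp add: field_simps)
    hence "(1 - 3/4 * x) / (1 - x / 4) \<le> 1 - x / 2" using x by (subst pos_divide_le_eq) auto
    also have "\<dots> \<le> exp (- x / 2)" using exp_ge_add_one_self[of "- x / 2"] by simp
    finally have "(1 - 3/4 * x) / (1 - x / 4) / (1 - x) \<le> exp (- x / 2) / (1 - x)"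
      using x by (intro divide_right_mono) auto
    thus "0 \<le> 1 / (1 - real p powr - s / 4) * ((1 - 3/4 * real p powr - s) / (1 - real p powr - s)) \<and>
      1 / (1 - real p powr - s / 4) * ((1 - 3/4 * real p powr - s) / (1 - real p powr - s))
        \<le> 1 / (1 - real p powr - s) * exp (- (real p powr - s) / 2)"
      using x unfolding x_def[symmetric] by (auto simp: mult_ac intro!: divide_nonneg_nonneg mult_nonneg_nonneg)
  qed
  also have "\<dots> = euler_product P s * exp (- (\<Sum>p\<in>P. real p powr - s) / 2)"
    unfolding prod.distrib euler_product_def
    by (simp add: exp_sum[OF P(1), symmetric] sum_negf sum_divide_distrib)
  finally show ?thesis .
qed

section \<open>Concentration of the Rankin measure\<close>

text \<open>The mean of \<open>ln n\<close> under the probability measure on \<open>smooth_over P\<close> with weights proportional to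
  \<open>n\<^sup>-\<^sup>s\<close>, equivalently minus the logarithmic derivative of \<open>euler_product P\<close>.  The saddle point is the
  exponent at which it equals \<open>ln x\<close>.\<close>

definition log_mean :: "nat set \<Rightarrow> real \<Rightarrow> real" where
  "log_mean P s = (\<Sum>p\<in>P. ln (real p) / (real p powr s - 1))"

lemma euler_product_pos:
  assumes "\<And>p. p \<in> P \<Longrightarrow> prime p" "0 < s"
  shows "0 < euler_product P s"
  unfolding euler_product_def using powr_neg_prime_bounds[OF assms(1) assms(2)]
  by (intro prod_pos) auto

text \<open>Convexity of \<open>s \<mapsto> ln (euler_product P s)\<close>: the graph lies above its tangent at \<open>t\<close>.  Valid
  for \<open>t\<close> on either side of \<open>s\<close>, hence usable for both tails.\<close>

lemma euler_product_shift_le: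
  assumes P: "finite P" "\<And>p. p \<in> P \<Longrightarrow> prime p" and s: "0 < s" and t: "0 < t"
  shows "euler_product P t \<le> euler_product P s * exp ((s - t) * log_mean P t)"
proof -
  have "euler_product P t \<le> (\<Prod>p\<in>P. 1 / (1 - real p powr - s) * exp ((s - t) * (ln (real p) / (real p powr t - 1))))"
    unfolding euler_product_def
  proof (rule prod_mono)
    fix p assume p: "p \<in> P"
    define x z where "x = real p powr - s" and "z = real p powr - t"
    have xz: "0 < x" "x < 1" "0 < z" "z < 1"
      using powr_neg_prime_bounds[OF P(2)[OF p]] s t by (auto simp: x_def z_def)
    have p1: "1 < real p" using prime_gt_1_nat[OF P(2)[OF p]] by simp
    have "x = z * exp (- ((s - t) * ln (real p)))"
      using p1 by (simp add: x_def z_def powr_def algebra_simps flip: exp_add)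
    moreover have "z * (1 - (s - t) * ln (real p)) \<le> z * exp (- ((s - t) * ln (real p)))"
      using exp_ge_add_one_self[of "- ((s - t) * ln (real p))"] xz by (intro mult_left_mono) auto
    ultimately have "1 - x \<le> 1 - z + z * ((s - t) * ln (real p))" by (simp add: algebra_simps)
    hence "(1 - x) / (1 - z) \<le> (1 - z + z * ((s - t) * ln (real p))) / (1 - z)"
      using xz by (intro divide_right_mono) auto
    also have "\<dots> = 1 + (s - t) * (ln (real p) / (real p powr t - 1))"
    proof -
      have "real p powr t - 1 = (1 - z) / z"
        using p1 by (simp add: z_def powr_minus field_simps)
      thus ?thesis using xz by (simp add: add_divide_distrib mult_ac)
    qed
    also have "\<dots> \<le> exp ((s - t) * (ln (real p) / (real p powr t - 1)))"
      by (rule exp_ge_add_one_self)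
    finally have "1 / (1 - z) \<le> 1 / (1 - x) * exp ((s - t) * (ln (real p) / (real p powr t - 1)))"
      using xz by (simp add: field_simps)
    thus "0 \<le> 1 / (1 - real p powr - t) \<and> 1 / (1 - real p powr - t) \<le>
        1 / (1 - real p powr - s) * exp ((s - t) * (ln (real p) / (real p powr t - 1)))"
      using xz by (simp add: x_def z_def)
  qed
  also have "\<dots> = euler_product P s * exp ((s - t) * log_mean P t)"
    unfolding prod.distrib euler_product_def log_mean_def
    by (simp add: exp_sum[OF P(1), symmetric] sum_distrib_left)
  finally show ?thesis .
qed

lemma seven_fifths_le_powr:
  assumes "2 \<le> (z::real)" "1/2 \<le> s"
  shows "7/5 \<le> z powr s"
proof -
  have "(7/5)\<^sup>2 \<le> (2::real)" by (simp add: power2_eq_square)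
  hence "7/5 \<le> sqrt (2::real)" by (rule real_le_rsqrt)
  also have "sqrt 2 = 2 powr (1/2)" by (simp add: powr_half_sqrt)
  also have "\<dots> \<le> 2 powr s" using assms by simp
  also have "\<dots> \<le> z powr s" using assms by (intro powr_mono2) auto
  finally show ?thesis .
qed

text \<open>Shifting the exponent by \<open>\<eta> \<le> ln (1 + w) / ln y\<close> changes every \<open>p powr s\<close> by a factor at most
  \<open>1 + w\<close>.  As \<open>p powr s \<ge> 7/5\<close> stays away from one, the denominators \<open>p powr s - 1\<close> change
  by a factor \<open>1 + O(w)\<close> only.\<close>

lemma log_mean_shift:
  assumes P: "\<And>p. p \<in> P \<Longrightarrow> prime p \<and> real p \<le> y" and s: "1/2 \<le> s" and y: "1 < y"
    and w: "0 < w" "w \<le> 1/20" and \<eta>: "0 \<le> \<eta>" "\<eta> * ln y \<le> ln (1 + w)"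
  shows "log_mean P (s - \<eta>) \<le> (1 + 4 * w) * log_mean P s"
    and "(1 - 4 * w) * log_mean P s \<le> log_mean P (s + \<eta>)"
proof -
  have *: "ln (real p) / (real p powr (s - \<eta>) - 1) \<le> (1 + 4 * w) * (ln (real p) / (real p powr s - 1))
      \<and> (1 - 4 * w) * (ln (real p) / (real p powr s - 1)) \<le> ln (real p) / (real p powr (s + \<eta>) - 1)"
    if p: "p \<in> P" for p
  proof -
    have p2: "2 \<le> real p" using P[OF p] prime_ge_2_nat[of p] by simp
    define Z t where "Z = real p powr s" and "t = real p powr \<eta>"
    have Z: "7/5 \<le> Z" unfolding Z_def by (rule seven_fifths_le_powr[OF p2 s])
    have t1: "1 \<le> t" unfolding t_def using p2 \<eta> by (intro ge_one_powr_ge_zero) auto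
    have "t = exp (\<eta> * ln (real p))" using p2 by (simp add: t_def powr_def)
    also have "\<eta> * ln (real p) \<le> \<eta> * ln y" using P[OF p] p2 \<eta> by (intro mult_left_mono) auto
    hence "exp (\<eta> * ln (real p)) \<le> exp (ln (1 + w))" using \<eta> by (subst exp_le_cancel_iff) linarith
    also have "\<dots> = 1 + w" using w by simp
    finally have t2: "t \<le> 1 + w" .
    have sub: "real p powr (s - \<eta>) = Z / t" "real p powr (s + \<eta>) = Z * t"
      using p2 by (auto simp: Z_def t_def powr_diff powr_add)
    have ww: "w * w \<le> w / 20" using w by (simp add: field_simps)
    have "t * (Z - 1) \<le> (1 + w) * (Z - 1)" using t2 Z by (intro mult_right_mono) auto
    moreover have "(1 + 4 * w) * (Z - 1 - w) \<le> (1 + 4 * w) * (Z - t)" using t2 w by (intro mult_left_mono) auto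
    moreover have "(1 + w) * (Z - 1) \<le> (1 + 4 * w) * (Z - 1 - w)"
    proof -
      have "w * (7/5) \<le> w * Z" using Z w by (intro mult_left_mono) auto
      thus ?thesis using ww by (simp add: algebra_simps)
    qed
    ultimately have "t * (Z - 1) \<le> (1 + 4 * w) * (Z - t)" by linarith
    hence "1 / (Z / t - 1) \<le> (1 + 4 * w) * (1 / (Z - 1))"
      using Z t1 t2 w by (simp add: field_simps)
    hence a: "ln (real p) * (1 / (Z / t - 1)) \<le> ln (real p) * ((1 + 4 * w) * (1 / (Z - 1)))"
      using p2 by (intro mult_left_mono) auto
    have Zt: "Z \<le> Z * t" using Z t1 by simp
    have "(1 - 4 * w) * (Z * t - 1) \<le> Z - 1"
    proof -
      have "Z * t - 1 \<le> Z * (1 + w) - 1" using t2 Z by simp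
      hence "(1 - 4 * w) * (Z * t - 1) \<le> (1 - 4 * w) * (Z * (1 + w) - 1)" using w by (intro mult_left_mono) auto
      also have "\<dots> \<le> Z - 1"
      proof -
        have "w * (7/5) \<le> w * Z" using Z w by (intro mult_left_mono) auto
        hence "4 * w \<le> 3 * (w * Z)" using w by linarith
        moreover have "0 \<le> (w * w) * Z" using Z by simp
        moreover have "(1 - 4 * w) * (Z * (1 + w) - 1) = Z - 1 + (4 * w - 3 * (w * Z)) - 4 * ((w * w) * Z)"
          by (simp add: algebra_simps)
        ultimately show ?thesis by linarith
      qed
      finally show ?thesis .
    qed
    hence "(1 - 4 * w) * (1 / (Z - 1)) \<le> 1 / (Z * t - 1)"
    proof -
      have "0 < Z - 1" "0 < Z * t - 1" using Z Zt by linarith+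
      thus ?thesis using \<open>(1 - 4 * w) * (Z * t - 1) \<le> Z - 1\<close>
        by (simp add: pos_le_divide_eq pos_divide_le_eq)
    qed
    hence "ln (real p) * ((1 - 4 * w) * (1 / (Z - 1))) \<le> ln (real p) * (1 / (Z * t - 1))"
      using p2 by (intro mult_left_mono) auto
    thus ?thesis using a by (simp add: sub mult_ac flip: Z_def)
  qed
  show "log_mean P (s - \<eta>) \<le> (1 + 4 * w) * log_mean P s"
    unfolding log_mean_def sum_distrib_left using * by (intro sum_mono) blast
  show "(1 - 4 * w) * log_mean P s \<le> log_mean P (s + \<eta>)"
    unfolding log_mean_def sum_distrib_left using * by (intro sum_mono) blast
qed

text \<open>A Chernoff bound.  The mass of \<open>ln n > l\<close> is at most \<open>exp (- \<eta> l) * euler_product P (s - \<eta>)\<close> and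
  that of \<open>ln n \<le> (1 - 3 e) l\<close> is bounded similarly with \<open>s + \<eta>\<close>.  Because the mean
  \<open>(1 - 2 e) l\<close> is at distance at least \<open>e l\<close> from both ends, and the shift perturbs it by less than
  half of that, each tail is at most the fraction \<open>exp (- \<eta> l e / 2) \<le> 1/4\<close> of the whole.  The mean is placed strictly below
  \<open>l\<close> so that the surviving half of the mass sits on \<open>n \<le> exp l\<close>.\<close>

lemma rankin_measure_concentration:
  assumes P: "finite P" "\<And>p. p \<in> P \<Longrightarrow> prime p \<and> real p \<le> y" and s: "1/2 \<le> s" and y: "2 \<le> y"
    and e: "0 < e" "e \<le> 1/4" and mean: "log_mean P s = (1 - 2 * e) * l"
    and l: "0 < l" and large: "ln 4 \<le> ln (1 + e / 8) * (l / ln y) * (e / 2)"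
  shows "euler_product P s \<le> 2 * (\<Sum>n\<in>{n\<in>smooth_over P. (1 - 3 * e) * l < ln (real n) \<and> ln (real n) \<le> l}. real n powr - s)"
proof -
  define w where "w = e / 8"
  define \<eta> where "\<eta> = ln (1 + w) / ln y"
  define E where "E = euler_product P s"
  define W where "W = {n\<in>smooth_over P. (1 - 3 * e) * l < ln (real n) \<and> ln (real n) \<le> l}"
  have w: "0 < w" "w \<le> 1/20" using e by (auto simp: w_def)
  have lny: "0 < ln y" using y by simp
  have \<eta>: "0 < \<eta>" "\<eta> * ln y = ln (1 + w)" using w lny by (auto simp: \<eta>_def)
  have "ln (1 + w) \<le> w" using w by (intro ln_add_one_self_le_self) auto
  moreover have "1/2 \<le> ln (2::real)" using exp_half_le2 by (subst ln_ge_iff) auto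
  moreover have "ln 2 \<le> ln y" using y by simp
  ultimately have "\<eta> < 1/2" using w lny by (simp add: \<eta>_def field_simps)
  hence pos: "0 < s - \<eta>" "0 < s + \<eta>" "0 < s" using s \<eta> by auto
  have pr: "prime p" if "p \<in> P" for p using P(2)[OF that] by simp
  have y1: "1 < y" using y by simp
  have shift: "log_mean P (s - \<eta>) \<le> (1 + 4 * w) * log_mean P s"
      "(1 - 4 * w) * log_mean P s \<le> log_mean P (s + \<eta>)"
    by (intro log_mean_shift[of P y] P(2) s y1 w less_imp_le[OF \<eta>(1)] eq_refl[OF \<eta>(2)]; assumption)+
  have \<eta>l: "\<eta> * l * (e / 2) \<ge> ln 4" using large by (simp add: \<eta>_def w_def field_simps)
  have E0: "0 < E" unfolding E_def by (rule euler_product_pos[OF pr pos(3)])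
  have finW: "finite W"
  proof (rule finite_subset)
    show "W \<subseteq> {..nat \<lfloor>exp l\<rfloor>}"
    proof
      fix n assume n: "n \<in> W"
      hence "0 < real n" "ln (real n) \<le> l" by (auto simp: W_def smooth_over_def)
      hence "real n \<le> exp l" by (metis exp_le_cancel_iff exp_ln)
      thus "n \<in> {..nat \<lfloor>exp l\<rfloor>}" by (simp add: le_nat_iff le_floor_iff)
    qed
  qed simp
  have up: "exp (- \<eta> * l) * euler_product P (s - \<eta>) \<le> E / 4"
  proof -
    have "euler_product P (s - \<eta>) \<le> E * exp (\<eta> * log_mean P (s - \<eta>))"
      using euler_product_shift_le[OF P(1) pr pos(3) pos(1)] by (simp add: E_def)
    also have "\<dots> \<le> E * exp (\<eta> * ((1 + 4 * w) * ((1 - 2 * e) * l)))"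
      using shift(1) E0 \<eta> unfolding mean by (intro mult_left_mono) auto
    finally have "exp (- \<eta> * l) * euler_product P (s - \<eta>)
        \<le> exp (- \<eta> * l) * (E * exp (\<eta> * ((1 + 4 * w) * ((1 - 2 * e) * l))))"
      by (intro mult_left_mono) auto
    also have "\<dots> = E * exp (\<eta> * l * ((1 + 4 * w) * (1 - 2 * e) - 1))"
      by (simp add: algebra_simps flip: exp_add)
    also have "\<dots> \<le> E * exp (\<eta> * l * (- (e / 2)))"
    proof -
      have "(1 + 4 * w) * (1 - 2 * e) - 1 = - (3/2 * e) - e\<^sup>2" by (simp add: w_def algebra_simps power2_eq_square)
      also have "\<dots> \<le> - (e / 2)" using e zero_le_power2[of e] by linarith
      finally have "(1 + 4 * w) * (1 - 2 * e) - 1 \<le> - (e / 2)" .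
      hence "\<eta> * l * ((1 + 4 * w) * (1 - 2 * e) - 1) \<le> \<eta> * l * (- (e / 2))"
        using \<eta> l by (intro mult_left_mono) auto
      thus ?thesis using E0 by (intro mult_left_mono) auto
    qed
    also have "\<dots> \<le> E * exp (- ln 4)" using E0 \<eta>l by (intro mult_left_mono) auto
    also have "\<dots> = E / 4" by (simp add: exp_minus)
    finally show ?thesis .
  qed
  have lo: "exp (\<eta> * ((1 - 3 * e) * l)) * euler_product P (s + \<eta>) \<le> E / 4"
  proof -
    have "euler_product P (s + \<eta>) \<le> E * exp (- \<eta> * log_mean P (s + \<eta>))"
      using euler_product_shift_le[OF P(1) pr pos(3) pos(2)] by (simp add: E_def)
    also have "\<dots> \<le> E * exp (- \<eta> * ((1 - 4 * w) * ((1 - 2 * e) * l)))"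
      using shift(2) E0 \<eta> unfolding mean by (intro mult_left_mono) auto
    finally have "exp (\<eta> * ((1 - 3 * e) * l)) * euler_product P (s + \<eta>)
        \<le> exp (\<eta> * ((1 - 3 * e) * l)) * (E * exp (- \<eta> * ((1 - 4 * w) * ((1 - 2 * e) * l))))"
      by (intro mult_left_mono) auto
    also have "\<dots> = E * exp (\<eta> * l * ((1 - 3 * e) - (1 - 4 * w) * (1 - 2 * e)))"
      by (simp add: algebra_simps flip: exp_add)
    also have "\<dots> \<le> E * exp (\<eta> * l * (- (e / 2)))"
    proof -
      have "(1 - 3 * e) - (1 - 4 * w) * (1 - 2 * e) = - (e / 2) - e\<^sup>2" by (simp add: w_def algebra_simps power2_eq_square)
      also have "\<dots> \<le> - (e / 2)" using e zero_le_power2[of e] by linarith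
      finally have "(1 - 3 * e) - (1 - 4 * w) * (1 - 2 * e) \<le> - (e / 2)" .
      hence "\<eta> * l * ((1 - 3 * e) - (1 - 4 * w) * (1 - 2 * e)) \<le> \<eta> * l * (- (e / 2))"
        using \<eta> l by (intro mult_left_mono) auto
      thus ?thesis using E0 by (intro mult_left_mono) auto
    qed
    also have "\<dots> \<le> E * exp (- ln 4)" using E0 \<eta>l by (intro mult_left_mono) auto
    also have "\<dots> = E / 4" by (simp add: exp_minus)
    finally show ?thesis .
  qed
  let ?g = "\<lambda>n. (if n \<in> W then real n powr - s else 0) + exp (- \<eta> * l) * real n powr - (s - \<eta>)
      + exp (\<eta> * ((1 - 3 * e) * l)) * real n powr - (s + \<eta>)"
  \<comment> \<open>Termwise domination: outside the window one of the two exponentials in \<open>?g\<close>, rescaled, is at least one.\<close>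
  have gs: "(?g has_sum ((\<Sum>n\<in>W. real n powr - s) + exp (- \<eta> * l) * euler_product P (s - \<eta>)
      + exp (\<eta> * ((1 - 3 * e) * l)) * euler_product P (s + \<eta>))) (smooth_over P)"
    by (intro has_sum_add has_sum_cmult_right has_sum_euler_product P(1) pr pos
        has_sum_finite_neutralI[OF finW]) (auto simp: W_def)
  have "E \<le> (\<Sum>n\<in>W. real n powr - s) + exp (- \<eta> * l) * euler_product P (s - \<eta>)
      + exp (\<eta> * ((1 - 3 * e) * l)) * euler_product P (s + \<eta>)"
    unfolding E_def
  proof (rule has_sum_mono[OF has_sum_euler_product[OF P(1) pr pos(3)] gs])
    fix n assume n: "n \<in> smooth_over P"
    hence n0: "0 < real n" by (simp add: smooth_over_def)
    have a: "exp (- \<eta> * l) * real n powr - (s - \<eta>) = real n powr - s * exp (\<eta> * (ln (real n) - l))"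
      "exp (\<eta> * ((1 - 3 * e) * l)) * real n powr - (s + \<eta>) = real n powr - s * exp (\<eta> * ((1 - 3 * e) * l - ln (real n)))"
      using n0 by (auto simp: powr_def algebra_simps simp flip: exp_add)
    have b: "1 \<le> exp (\<eta> * (ln (real n) - l)) \<or> 1 \<le> exp (\<eta> * ((1 - 3 * e) * l - ln (real n)))" if "n \<notin> W"
      using that n \<eta> by (auto simp: W_def)
    show "real n powr - s \<le> ?g n"
    proof (cases "n \<in> W")
      case False
      have "real n powr - s * 1 \<le> real n powr - s * (exp (\<eta> * (ln (real n) - l)) + exp (\<eta> * ((1 - 3 * e) * l - ln (real n))))"
        using b[OF False] by (intro mult_left_mono) (auto intro: add_increasing add_increasing2)
      thus ?thesis using False unfolding a by (simp add: algebra_simps)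
    qed auto
  qed
  with up lo have "E \<le> 2 * (\<Sum>n\<in>W. real n powr - s)" by linarith
  thus ?thesis by (simp add: E_def W_def)
qed

section \<open>Filling in the top window\<close>

definition mass :: "nat set \<Rightarrow> real \<Rightarrow> real \<Rightarrow> real \<Rightarrow> real" where
  "mass P s a b = (\<Sum>n\<in>{n\<in>smooth_over P. a < real n \<and> real n \<le> b}. real n powr - s)"

lemma finite_nat_le_real [simp]: "finite {n::nat. Q n \<and> R n \<and> real n \<le> b}" "finite {n::nat. Q n \<and> real n \<le> b}"
  by (rule finite_subset[of _ "{..nat \<lfloor>b\<rfloor>}"]; auto simp: le_nat_iff le_floor_iff)+

lemma mass_nonneg: "0 \<le> mass P s a b"
  unfolding mass_def by (intro sum_nonneg) auto

lemma mass_split: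
  assumes "a \<le> b" "b \<le> c"
  shows "mass P s a c = mass P s a b + mass P s b c"
proof -
  have "{n\<in>smooth_over P. a < real n \<and> real n \<le> c}
      = {n\<in>smooth_over P. a < real n \<and> real n \<le> b} \<union> {n\<in>smooth_over P. b < real n \<and> real n \<le> c}"
    using assms by auto
  thus ?thesis unfolding mass_def by (simp only:, subst sum.union_disjoint) auto
qed

lemma card_large_prime_divisors:
  fixes r x :: real
  assumes r: "1 < r" and n: "0 < n" "real n \<le> x"
    and Q: "finite Q" "\<And>p. p \<in> Q \<Longrightarrow> prime p \<and> p dvd n \<and> r < real p"
  shows "real (card Q) * ln r \<le> ln x"
proof -
  have "\<Prod>Q dvd n" using Q by (intro prod_distinct_primes_dvd) auto
  hence "\<Prod>Q \<le> n" using n by (intro dvd_imp_le) auto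
  hence "real (\<Prod>Q) \<le> x" using n(2) by linarith
  moreover have "r ^ card Q \<le> real (\<Prod>Q)"
  proof -
    have "r ^ card Q = (\<Prod>p\<in>Q. r)" by simp
    also have "\<dots> \<le> (\<Prod>p\<in>Q. real p)" using Q r by (intro prod_mono) (auto intro: less_imp_le)
    finally show ?thesis by simp
  qed
  ultimately have "r ^ card Q \<le> x" by linarith
  hence "ln (r ^ card Q) \<le> ln x" using r n by (subst ln_le_cancel_iff) auto
  thus ?thesis using r by (simp add: ln_realpow)
qed

text \<open>Multiplying the integers \<open>n\<close> in \<open>(z / r, z]\<close> by the primes \<open>p\<close> in \<open>(r, r\<^sup>2]\<close> produces integers
  in \<open>(z, z r\<^sup>2]\<close>, and an integer \<open>m \<le> x\<close> arises at most as often as it has prime factors above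
  \<open>r\<close>, that is at most \<open>ln x / ln r\<close> times.\<close>

lemma mass_shift:
  fixes s :: real
  assumes P: "finite P" "\<And>p. p \<in> P \<Longrightarrow> prime p \<and> real p \<le> r\<^sup>2" and r: "1 < r"
    and z: "0 < z" "z * r\<^sup>2 \<le> x"
  defines "W \<equiv> (\<Sum>p\<in>{p\<in>P. r < real p}. real p powr - s)"
  shows "W * mass P s (z / r) z \<le> ln x / ln r * mass P s z (z * r\<^sup>2)"
proof -
  define Q where "Q = {p\<in>P. r < real p}"
  define A where "A = {n\<in>smooth_over P. z / r < real n \<and> real n \<le> z}"
  define B where "B = {n\<in>smooth_over P. z < real n \<and> real n \<le> z * r\<^sup>2}"
  have fin: "finite Q" "finite A" "finite B" using P(1) by (auto simp: Q_def A_def B_def)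
  have "W * mass P s (z / r) z = (\<Sum>(n, p)\<in>A \<times> Q. real n powr - s * real p powr - s)"
    unfolding W_def mass_def Q_def[symmetric] A_def[symmetric]
    by (subst mult.commute) (simp only: sum_product sum.cartesian_product)
  also have "\<dots> = (\<Sum>(n, p)\<in>A \<times> Q. real (n * p) powr - s)"
    by (intro sum.cong refl) (auto simp: powr_mult)
  also have "\<dots> \<le> (\<Sum>(m, p)\<in>(SIGMA m:B. {p\<in>Q. p dvd m}). real m powr - s)"
  proof -
    let ?f = "\<lambda>(n, p). (n * p, p)"
    have inj: "inj_on ?f (A \<times> Q)"
      using r by (auto intro!: inj_onI simp: Q_def)
    have sub: "?f ` (A \<times> Q) \<subseteq> (SIGMA m:B. {p\<in>Q. p dvd m})"
    proof safe
      fix n p assume np: "n \<in> A" "p \<in> Q"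
      have p: "prime p" "p \<in> P" "r < real p" "real p \<le> r\<^sup>2" "0 < p"
        using np(2) P(2) prime_gt_0_nat by (auto simp: Q_def)
      have n: "0 < n" "n \<in> smooth_over P" "z / r < real n" "real n \<le> z"
        using np(1) by (auto simp: A_def smooth_over_def)
      have "p \<in> smooth_over P" using p by (auto simp: smooth_over_def prime_prime_factors)
      hence "n * p \<in> smooth_over P" using n p by (simp add: smooth_over_mult_iff)
      moreover have "z < real n * real p"
      proof -
        have "z = z / r * r" using r by simp
        also have "\<dots> < real n * r" using n r by (intro mult_strict_right_mono) auto
        also have "\<dots> \<le> real n * real p" using p by (intro mult_left_mono) auto
        finally show ?thesis .
      qed
      moreover have "real n * real p \<le> z * r\<^sup>2" using n p z by (intro mult_mono) auto
      ultimately show "n * p \<in> B" by (simp add: B_def)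
    qed (auto simp: Q_def)
    have "(\<Sum>(n, p)\<in>A \<times> Q. real (n * p) powr - s) = (\<Sum>(m, p)\<in>?f ` (A \<times> Q). real m powr - s)"
      by (subst sum.reindex[OF inj]) (simp add: case_prod_unfold)
    also have "\<dots> \<le> (\<Sum>(m, p)\<in>(SIGMA m:B. {p\<in>Q. p dvd m}). real m powr - s)"
      using fin sub by (intro sum_mono2) auto
    finally show ?thesis .
  qed
  also have "\<dots> = (\<Sum>m\<in>B. \<Sum>p\<in>{p\<in>Q. p dvd m}. real m powr - s)"
    using fin by (intro sum.Sigma[symmetric]) auto
  also have "\<dots> = (\<Sum>m\<in>B. real (card {p\<in>Q. p dvd m}) * real m powr - s)" by simp
  also have "\<dots> \<le> (\<Sum>m\<in>B. ln x / ln r * real m powr - s)"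
  proof (intro sum_mono mult_right_mono)
    fix m assume m: "m \<in> B"
    have "real (card {p\<in>Q. p dvd m}) * ln r \<le> ln x"
      by (rule card_large_prime_divisors[OF r, of m])
         (use m z P fin in \<open>auto simp: B_def smooth_over_def Q_def\<close>)
    thus "real (card {p\<in>Q. p dvd m}) \<le> ln x / ln r" using r by (simp add: field_simps)
  qed auto
  finally show ?thesis by (simp add: mass_def B_def sum_distrib_left)
qed

text \<open>Let \<open>N k\<close> be the mass in \<open>(x / r ^ Suc k, x / r ^ k]\<close>.  The hypothesis says that the large primes
  carry a fixed proportion of the largest possible weight, so \<open>mass_shift\<close> becomes the recursion
  \<open>N (k + 2) \<le> 16 (N (k + 1) + N k)\<close>, whose growth rate is below \<open>17\<close>.  When \<open>K\<close> is a small multiple of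
  \<open>ln x / ln r\<close>, this loss is small compared with the saving.\<close>

lemma mass_top_window:
  assumes P: "finite P" "\<And>p. p \<in> P \<Longrightarrow> prime p \<and> real p \<le> r\<^sup>2" and r: "1 < r" and x: "1 < x"
    and W: "ln x / ln r \<le> 16 * (\<Sum>p\<in>{p\<in>P. r < real p}. real p powr - s)"
  shows "mass P s (x / r ^ K) x \<le> 17 ^ K * mass P s (x / r\<^sup>2) x"
proof -
  define W where "W = (\<Sum>p\<in>{p\<in>P. r < real p}. real p powr - s)"
  define N where "N k = mass P s (x / r ^ Suc k) (x / r ^ k)" for k
  define M where "M = mass P s (x / r\<^sup>2) x"
  have N0: "0 \<le> N k" for k by (simp add: N_def mass_nonneg)
  have M0: "0 \<le> M" by (simp add: M_def mass_nonneg)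
  have Wpos: "0 < W"
  proof -
    have "0 < ln x / ln r" using x r by simp
    thus ?thesis using W by (simp add: W_def)
  qed
  have mono: "x / r ^ Suc k \<le> x / r ^ k" for k
    using r x by (intro divide_left_mono) (auto intro: mult_pos_pos power_increasing)
  have M: "M = N 0 + N 1"
    unfolding M_def N_def using mass_split[of "x / r ^ 2" "x / r ^ 1" "x / r ^ 0" P s] mono[of 0] mono[of 1]
    by (simp add: numeral_2_eq_2)
  have rec: "N (Suc (Suc k)) \<le> 16 * (N (Suc k) + N k)" for k
  proof -
    have "W * mass P s (x / r ^ Suc (Suc k) / r) (x / r ^ Suc (Suc k))
        \<le> ln x / ln r * mass P s (x / r ^ Suc (Suc k)) (x / r ^ Suc (Suc k) * r\<^sup>2)"
      unfolding W_def
    proof (rule mass_shift[OF P r])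
      show "x / r ^ Suc (Suc k) * r\<^sup>2 \<le> x"
        using r x by (simp add: power2_eq_square field_simps)
    qed (use r x in auto)
    also have "x / r ^ Suc (Suc k) / r = x / r ^ Suc (Suc (Suc k))" by (simp add: mult_ac)
    also have "x / r ^ Suc (Suc k) * r\<^sup>2 = x / r ^ k" using r by (simp add: power2_eq_square)
    also have "mass P s (x / r ^ Suc (Suc k)) (x / r ^ k) = N (Suc k) + N k"
      unfolding N_def by (rule mass_split) (rule mono)+
    also have "ln x / ln r * (N (Suc k) + N k) \<le> 16 * W * (N (Suc k) + N k)"
      using W N0[of k] N0[of "Suc k"] by (intro mult_right_mono) (auto simp: W_def)
    finally have "W * N (Suc (Suc k)) \<le> W * (16 * (N (Suc k) + N k))"
      by (simp add: N_def mult_ac)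
    thus ?thesis using Wpos by simp
  qed
  have bound: "N k \<le> 17 ^ k * M \<and> N (Suc k) \<le> 17 ^ Suc k * M" for k
  proof (induction k)
    case 0
    show ?case using M N0[of 0] N0[of 1] M0 by simp
  next
    case (Suc k)
    have "N (Suc (Suc k)) \<le> 16 * (17 ^ Suc k * M + 17 ^ k * M)" 
      using Suc by (intro order_trans[OF rec mult_left_mono[OF add_mono]]) auto
    \<comment> \<open>\<open>16 * (17 + 1) = 288 \<le> 17\<^sup>2\<close>\<close>
    also have "\<dots> \<le> 17 ^ Suc (Suc k) * M" using M0 by (simp add: algebra_simps)
    finally show ?case using Suc by simp
  qed
  have "mass P s (x / r ^ K) x \<le> 17 ^ K * M"
  proof (induction K)
    case 0
    have "{n \<in> smooth_over P. x < real n \<and> real n \<le> x} = {}" by auto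
    hence "mass P s x x = 0" unfolding mass_def by (simp only: sum.empty)
    thus ?case using M0 by simp
  next
    case (Suc K)
    have "mass P s (x / r ^ Suc K) x = N K + mass P s (x / r ^ K) x"
      unfolding N_def using r x by (intro mass_split mono) (simp add: field_simps)
    also have "\<dots> \<le> 17 ^ K * M + 17 ^ K * M" using Suc bound[of K] by linarith
    also have "\<dots> \<le> 17 ^ Suc K * M" using M0 by simp
    finally show ?case .
  qed
  thus ?thesis by (simp add: M_def)
qed

section \<open>From Rankin mass to a count of smooth numbers\<close>

text \<open>Summing \<open>ln n \<ge> \<Sum> ln p\<close> over the smooth \<open>n \<le> x\<close> and writing \<open>n = m p\<close> bounds the sum of
  \<open>theta (x / m)\<close> over smooth \<open>m\<close>; the window \<open>x / y < m\<close> ensures that every prime \<open>p \<le> x / m\<close> is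
  admissible.  Chebyshev's bound makes \<open>theta (x / m)\<close> comparable with
  \<open>x / m \<ge> (x / m)\<^sup>s\<close>.  Counting the window trivially would lose a factor \<open>y\<^sup>s\<close>, which can
  exceed the saving.\<close>

lemma smooth_count_ge_mass:
  assumes y: "1 < y" and x: "1 \<le> x" and s: "s \<le> 1"
  shows "x powr s * mass (primes_le y) s (x / y) x
    \<le> exp 9 * (ln x + 1) * real (card {n\<in>smooth_over (primes_le y). real n \<le> x})"
proof -
  define S where "S = {n\<in>smooth_over (primes_le y). real n \<le> x}"
  define A where "A = {n\<in>smooth_over (primes_le y). x / y < real n \<and> real n \<le> x}"
  have fin: "finite S" "finite A" by (auto simp: S_def A_def)
  have "x powr s * mass (primes_le y) s (x / y) x = (\<Sum>m\<in>A. (x / real m) powr s)"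
    unfolding mass_def A_def[symmetric] sum_distrib_left
    using x by (intro sum.cong refl) (auto simp: A_def smooth_over_def powr_divide powr_minus field_simps)
  also have "\<dots> \<le> (\<Sum>m\<in>A. exp 9 * (theta (x / real m) + 1))"
  proof (rule sum_mono)
    fix m assume m: "m \<in> A"
    hence m': "0 < real m" "real m \<le> x" by (auto simp: A_def smooth_over_def)
    have "(x / real m) powr s \<le> (x / real m) powr 1" using m' s by (intro powr_mono) auto
    also have "\<dots> = exp 9 * (x / real m / exp 9)" using m' x by simp
    also have "\<dots> \<le> exp 9 * (theta (x / real m) + 1)"
      using theta_lower[of "x / real m"] m' x by (intro mult_left_mono) auto
    finally show "(x / real m) powr s \<le> exp 9 * (theta (x / real m) + 1)" .
  qed
  also have "\<dots> = exp 9 * ((\<Sum>m\<in>A. theta (x / real m)) + real (card A))"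
    by (simp add: sum.distrib flip: sum_distrib_left)
  also have "\<dots> \<le> exp 9 * (ln x * real (card S) + real (card S))"
  proof (intro mult_left_mono add_mono)
    have "A \<subseteq> S" by (auto simp: A_def S_def)
    thus "real (card A) \<le> real (card S)" using fin by (simp add: card_mono)
    have "(\<Sum>m\<in>A. theta (x / real m)) = (\<Sum>(m, p)\<in>(SIGMA m:A. primes_le (x / real m)). ln (real p))"
      unfolding theta_def using fin by (intro sum.Sigma) auto
    also have "\<dots> \<le> (\<Sum>(n, p)\<in>(SIGMA n:S. prime_factors n). ln (real p))"
    proof -
      let ?f = "\<lambda>(m, p). (m * p, p)"
      have inj: "inj_on ?f (SIGMA m:A. primes_le (x / real m))"
        by (auto intro!: inj_onI simp: primes_le_def)
      have sub: "?f ` (SIGMA m:A. primes_le (x / real m)) \<subseteq> (SIGMA n:S. prime_factors n)"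
      proof safe
        fix m p assume mp: "m \<in> A" "p \<in> primes_le (x / real m)"
        have m: "0 < m" "m \<in> smooth_over (primes_le y)" "x / y < real m"
          using mp(1) by (auto simp: A_def smooth_over_def)
        have p: "prime p" "real p \<le> x / real m" "0 < p"
          using mp(2) by (auto simp: primes_le_def prime_gt_0_nat)
        have "x / real m \<le> y" using m x y by (simp add: field_simps)
        hence "p \<in> smooth_over (primes_le y)"
          using p by (auto simp: smooth_over_def primes_le_def prime_prime_factors)
        moreover have "real m * real p \<le> x" using p m by (simp add: field_simps)
        ultimately show "m * p \<in> S" using m p by (simp add: S_def smooth_over_mult_iff)
        show "p \<in> prime_factors (m * p)" using m p by (auto simp: prime_factors_dvd)
      qed
      have "(\<Sum>(m, p)\<in>(SIGMA m:A. primes_le (x / real m)). ln (real p))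
          = (\<Sum>(n, p)\<in>?f ` (SIGMA m:A. primes_le (x / real m)). ln (real p))"
        by (subst sum.reindex[OF inj]) (simp add: case_prod_unfold)
      also have "\<dots> \<le> (\<Sum>(n, p)\<in>(SIGMA n:S. prime_factors n). ln (real p))"
        using fin sub by (intro sum_mono2) (auto dest!: in_prime_factors_imp_prime prime_gt_0_nat)
      finally show ?thesis .
    qed
    also have "\<dots> = (\<Sum>n\<in>S. \<Sum>p\<in>prime_factors n. ln (real p))"
      using fin by (intro sum.Sigma[symmetric]) auto
    also have "\<dots> \<le> (\<Sum>n\<in>S. ln x)"
    proof (rule sum_mono)
      fix n assume n: "n \<in> S"
      have n': "0 < n" "real n \<le> x" using n by (auto simp: S_def smooth_over_def)
      have "\<Prod>(prime_factors n) dvd n" by (rule prod_distinct_primes_dvd) auto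
      hence "\<Prod>(prime_factors n) \<le> n" using n' by (intro dvd_imp_le)
      hence le: "real (\<Prod>(prime_factors n)) \<le> x" using n' by linarith
      have pos: "0 < real p" if "p \<in> prime_factors n" for p
        using that by (auto dest!: in_prime_factors_imp_prime prime_gt_0_nat)
      have "(\<Sum>p\<in>prime_factors n. ln (real p)) = ln (\<Prod>p\<in>prime_factors n. real p)"
        by (rule ln_prod[symmetric]) (use pos in auto)
      also have "\<dots> \<le> ln x"
        using le pos x by (subst ln_le_cancel_iff) (auto intro!: prod_pos)
      finally show "(\<Sum>p\<in>prime_factors n. ln (real p)) \<le> ln x" .
    qed
    also have "\<dots> = ln x * real (card S)" by simp
    finally show "(\<Sum>m\<in>A. theta (x / real m)) \<le> ln x * real (card S)" .
  qed auto
  finally show ?thesis by (simp add: S_def algebra_simps)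
qed

section \<open>Prime sums at the saddle point\<close>

lemma ln_times_powr_neg:
  assumes "0 < real p"
  shows "ln (real p) * real p powr - s = ln (real p) / real p * real p powr (1 - s)"
  using assms by (simp add: powr_diff powr_minus field_simps)

lemma sum_ln_powr_upper:
  assumes s: "s \<le> 1" and z: "1 \<le> z"
  shows "(\<Sum>p\<in>primes_le z. ln (real p) * real p powr - s) \<le> z powr (1 - s) * (ln z + 4)"
proof -
  have "(\<Sum>p\<in>primes_le z. ln (real p) * real p powr - s) \<le> (\<Sum>p\<in>primes_le z. ln (real p) / real p * z powr (1 - s))"
  proof (rule sum_mono)
    fix p assume p: "p \<in> primes_le z"
    have p1: "1 < real p" "real p \<le> z" using p primes_le_gt_1[OF p] by (auto simp: primes_le_def)
    show "ln (real p) * real p powr - s \<le> ln (real p) / real p * z powr (1 - s)"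
      unfolding ln_times_powr_neg[OF order_less_trans[OF zero_less_one p1(1)]]
      using p1 s by (intro mult_left_mono powr_mono2) auto
  qed
  also have "\<dots> = z powr (1 - s) * mertens z" by (simp add: mertens_def sum_distrib_left mult_ac)
  also have "\<dots> \<le> z powr (1 - s) * (ln z + 4)" using mertens_bounds(2)[OF z] by (intro mult_left_mono) auto
  finally show ?thesis .
qed

text \<open>Only primes above \<open>y powr (3/4)\<close> are kept.  The exponent \<open>3/4\<close> exceeds the \<open>1/2\<close> that
  \<open>sum_ln_powr_upper\<close> gives at \<open>\<surd>y\<close>, and this difference is what makes the primes up to \<open>\<surd>y\<close>
  negligible in \<open>saddle_exponent\<close>.\<close>

lemma sum_ln_powr_lower:
  assumes s: "s \<le> 1" and y: "1 < y" "64 \<le> ln y"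
  shows "y powr (3/4 * (1 - s)) * (ln y / 8) \<le> (\<Sum>p\<in>primes_le y. ln (real p) * real p powr - s)"
proof -
  define w where "w = y powr (3/4)"
  have w: "1 \<le> w" "w \<le> y" "ln w = 3/4 * ln y"
    using y powr_mono[of "3/4" 1 y] by (auto simp: w_def ge_one_powr_ge_zero ln_powr)
  have "ln y / 8 \<le> mertens y - mertens w"
    using mertens_bounds(1)[of y] mertens_bounds(2)[OF w(1)] w y by linarith
  also have "\<dots> = (\<Sum>p\<in>primes_le y - primes_le w. ln (real p) / real p)"
    unfolding mertens_def using primes_le_mono[OF w(2)] by (intro sum_diff[symmetric]) auto
  finally have "w powr (1 - s) * (ln y / 8) \<le> w powr (1 - s) * (\<Sum>p\<in>primes_le y - primes_le w. ln (real p) / real p)"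
    by (intro mult_left_mono) auto
  also have "\<dots> = (\<Sum>p\<in>primes_le y - primes_le w. ln (real p) / real p * w powr (1 - s))"
    by (simp add: sum_distrib_left mult_ac)
  also have "\<dots> \<le> (\<Sum>p\<in>primes_le y - primes_le w. ln (real p) * real p powr - s)"
  proof (rule sum_mono)
    fix p assume p: "p \<in> primes_le y - primes_le w"
    have p1: "1 < real p" "w \<le> real p" using p primes_le_gt_1[of p y] by (auto simp: primes_le_def)
    show "ln (real p) / real p * w powr (1 - s) \<le> ln (real p) * real p powr - s"
      unfolding ln_times_powr_neg[OF order_less_trans[OF zero_less_one p1(1)]]
      using p1 s w by (intro mult_left_mono powr_mono2) auto
  qed
  also have "\<dots> \<le> (\<Sum>p\<in>primes_le y. ln (real p) * real p powr - s)"
    by (intro sum_mono2) (auto intro!: mult_nonneg_nonneg ln_ge_zero dest!: primes_le_gt_1)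
  also have "w powr (1 - s) = y powr (3/4 * (1 - s))" by (simp add: w_def powr_powr)
  finally show ?thesis .
qed

lemma inverse_powr_minus_one_bounds:
  assumes "2 \<le> (z::real)" "1/2 \<le> s"
  shows "z powr - s \<le> 1 / (z powr s - 1)" "1 / (z powr s - 1) \<le> 7/2 * z powr - s"
proof -
  define Z where "Z = z powr s"
  have Z: "7/5 \<le> Z" unfolding Z_def by (rule seven_fifths_le_powr[OF assms])
  have "1 / Z \<le> 1 / (Z - 1)" "1 / (Z - 1) \<le> 7/2 * (1 / Z)" using Z by (auto simp: field_simps)
  thus "z powr - s \<le> 1 / (z powr s - 1)" "1 / (z powr s - 1) \<le> 7/2 * z powr - s"
    by (auto simp: Z_def powr_minus_divide)
qed

text \<open>All properties of the saddle point are read off from its equation by monotonicity and Mertens'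
  estimate.  If \<open>s > 1\<close>, the prime sum would be \<open>O(ln y)\<close>, less than \<open>0.998 l\<close>; if \<open>s < 1/2\<close>, it would be at least
  \<open>y powr (3/8)\<close>, which exceeds \<open>l\<close> because \<open>y \<ge> l ^ 6\<close>.  Dividing the equation by \<open>ln y \<ge> ln p\<close>
  bounds \<open>\<Sum> p powr - s\<close> below.  The primes up to \<open>\<surd>y\<close> contribute at most half: with
  \<open>E = y powr ((1 - s) / 4)\<close> they account for \<open>O(E\<^sup>2 ln y)\<close> out of at least \<open>E\<^sup>3 ln y / 8\<close>, and the total
  is also a large multiple of \<open>ln y\<close>, which covers bounded \<open>E\<close>.\<close>

lemma saddle_exponent:
  assumes y: "2 \<le> y" "64 \<le> ln y" and l: "10 ^ 8 * ln y \<le> l" and ly: "l ^ 6 \<le> y"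
  obtains s where "1/2 \<le> s" "s \<le> 1" "log_mean (primes_le y) s = (998/1000) * l"
    "l / ln y \<le> 8 * (\<Sum>p\<in>{p\<in>primes_le y. sqrt y < real p}. real p powr - s)"
    "(2/7) * (998/1000) * (l / ln y) \<le> (\<Sum>p\<in>primes_le y. real p powr - s)"
proof -
  define L where "L = (998/1000) * l"
  define P where "P = primes_le y"
  have lny: "0 < ln y" "1 < y" using y by auto
  have l': "100000000 * ln y \<le> l" using l by simp
  have l0: "1 \<le> l" "0 < l" using l' y by linarith+
  have L: "0 < L" "l / 2 \<le> L" "L < l" "L \<le> l" "3 * ln y < L"
    unfolding L_def using l' l0 lny by linarith+
  have pp: "prime p" "2 \<le> real p" "real p \<le> y" "0 < ln (real p)" if "p \<in> P" for p
    using that primes_le_ge_2[of p y] by (auto simp: P_def primes_le_def)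
  have finP: "finite P" by (simp add: P_def)
  obtain s where s: "0 < s" "log_mean P s = L"
    using saddle_point_ex1[OF y(1), of "exp L"] L by (auto simp: log_mean_def P_def primes_le_def)
  have anti: "log_mean P t \<le> log_mean P s" if "0 < s" "s \<le> t" for s t
    unfolding log_mean_def
  proof (intro sum_mono divide_left_mono mult_pos_pos)
    fix p assume p: "p \<in> P"
    have "1 < real p powr s" using pp[OF p] that by simp
    moreover have "real p powr s \<le> real p powr t" using pp[OF p] that by (intro powr_mono) auto
    ultimately show "real p powr s - 1 \<le> real p powr t - 1" "0 < real p powr s - 1" "0 < real p powr t - 1"
      by auto
  qed (use pp in \<open>auto intro: less_imp_le\<close>)
  have s1: "s \<le> 1"
  proof (rule ccontr)
    assume "\<not> s \<le> 1"
    hence "L \<le> log_mean P 1" using anti[of 1 s] s by simp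
    also have "\<dots> \<le> (\<Sum>p\<in>P. 2 * (ln (real p) / real p))"
      unfolding log_mean_def
    proof (rule sum_mono)
      fix p assume p: "p \<in> P"
      have "1 / (real p - 1) \<le> 2 / real p" using pp[OF p] by (simp add: field_simps)
      hence "ln (real p) * (1 / (real p - 1)) \<le> ln (real p) * (2 / real p)"
        using pp[OF p] by (intro mult_left_mono) auto
      thus "ln (real p) / (real p powr 1 - 1) \<le> 2 * (ln (real p) / real p)"
        using pp[OF p] by (simp add: mult.commute)
    qed
    also have "\<dots> = 2 * mertens y" by (simp add: mertens_def P_def sum_distrib_left)
    also have "\<dots> \<le> 2 * ln y + 8" using mertens_bounds(2)[of y] y by simp
    finally show False using L y by linarith
  qed
  have low: "(\<Sum>p\<in>P. ln (real p) * real p powr - t) \<le> log_mean P t" if "1/2 \<le> t" for t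
    unfolding log_mean_def
  proof (rule sum_mono)
    fix p assume p: "p \<in> P"
    have "ln (real p) * real p powr - t \<le> ln (real p) * (1 / (real p powr t - 1))"
      using pp[OF p] inverse_powr_minus_one_bounds(1)[OF _ that] by (intro mult_left_mono) auto
    thus "ln (real p) * real p powr - t \<le> ln (real p) / (real p powr t - 1)" by simp
  qed
  have s2: "1/2 \<le> s"
  proof (rule ccontr)
    assume "\<not> 1/2 \<le> s"
    hence "log_mean P (1/2) \<le> L" using anti[of s "1/2"] s by simp
    hence "y powr (3/4 * (1 - 1/2)) * (ln y / 8) \<le> L"
      using sum_ln_powr_lower[of "1/2" y] low[of "1/2"] lny y by (simp add: P_def)
    moreover have "y powr (3/8) * 8 \<le> y powr (3/8) * (ln y / 8)" using y by (intro mult_left_mono) auto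
    moreover have "l \<le> y powr (3/8)"
    proof -
      \<comment> \<open>\<open>9/4 = 6 * (3/8)\<close>\<close>
      have "l powr 1 \<le> l powr (9/4)" using l0 by (intro powr_mono) auto
      also have "\<dots> = (l ^ 6) powr (3/8)" using l0 by (simp add: powr_powr flip: powr_numeral)
      also have "\<dots> \<le> y powr (3/8)" using ly l0 by (intro powr_mono2) auto
      finally show ?thesis using l0 by simp
    qed
    ultimately show False using L by simp
  qed
  have up: "ln (real p) / (real p powr s - 1) \<le> 7/2 * (ln (real p) * real p powr - s)" if "p \<in> P" for p
  proof -
    have "ln (real p) * (1 / (real p powr s - 1)) \<le> ln (real p) * (7/2 * real p powr - s)"
      using pp[OF that] inverse_powr_minus_one_bounds(2)[OF _ s2] by (intro mult_left_mono) auto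
    thus ?thesis by simp
  qed
  define R where "R = sqrt y"
  have R: "1 \<le> R" "ln R = ln y / 2" "R \<le> y"
    using y lny by (auto simp: R_def ln_sqrt intro!: real_le_lsqrt power2_nonneg_ge_1_iff self_le_power)
  define Q where "Q = {p\<in>P. R < real p}"
  define E where "E = y powr ((1 - s) / 4)"
  have small: "(\<Sum>p\<in>primes_le R. ln (real p) / (real p powr s - 1)) \<le> L / 2"
  proof -
    have "(\<Sum>p\<in>primes_le R. ln (real p) / (real p powr s - 1)) \<le> (\<Sum>p\<in>primes_le R. 7/2 * (ln (real p) * real p powr - s))"
      using primes_le_mono[OF R(3)] by (intro sum_mono up) (auto simp: P_def)
    also have "\<dots> = 7/2 * (\<Sum>p\<in>primes_le R. ln (real p) * real p powr - s)" by (rule sum_distrib_left[symmetric])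
    also have "\<dots> \<le> 7/2 * (R powr (1 - s) * (ln R + 4))" using sum_ln_powr_upper[OF s1 R(1)] by simp
    also have "R powr (1 - s) = E\<^sup>2"
      using y by (simp add: R_def E_def powr_half_sqrt[symmetric] powr_powr power2_eq_square flip: powr_add)
    also have "7/2 * (E\<^sup>2 * (ln R + 4)) \<le> 7/2 * (E\<^sup>2 * ln y)" using R y by (intro mult_left_mono) auto
    also have "\<dots> \<le> L / 2"
    proof (cases "56 \<le> E")
      case True
      have "E ^ 3 * (ln y / 8) \<le> log_mean P s"
      proof -
        have "E ^ 3 = y powr (3/4 * (1 - s))"
          using y by (simp add: E_def power3_eq_cube flip: powr_add)
        thus ?thesis using sum_ln_powr_lower[OF s1 lny(2) y(2)] low[OF s2] by (simp add: P_def)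
      qed
      moreover have "56 * (E\<^sup>2 * ln y) \<le> E * (E\<^sup>2 * ln y)" using True lny by (intro mult_right_mono) auto
      ultimately show ?thesis using s by (simp add: power3_eq_cube power2_eq_square)
    next
      case False
      have "0 \<le> E" by (simp add: E_def)
      hence "E\<^sup>2 \<le> 56\<^sup>2" using False by (intro power_mono) auto
      hence "E\<^sup>2 * ln y \<le> 56\<^sup>2 * ln y" using lny by (intro mult_right_mono) auto
      hence "E\<^sup>2 * ln y \<le> 3136 * ln y" by simp
      thus ?thesis using L l' lny by linarith
    qed
    finally show ?thesis .
  qed
  have "L = (\<Sum>p\<in>primes_le R. ln (real p) / (real p powr s - 1)) + (\<Sum>p\<in>Q. ln (real p) / (real p powr s - 1))"
  proof -
    have "P = primes_le R \<union> Q" using R by (auto simp: P_def Q_def primes_le_def)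
    moreover have "primes_le R \<inter> Q = {}" by (auto simp: Q_def primes_le_def)
    ultimately have "log_mean P s = (\<Sum>p\<in>primes_le R. ln (real p) / (real p powr s - 1)) + (\<Sum>p\<in>Q. ln (real p) / (real p powr s - 1))"
      unfolding log_mean_def using finP by (simp add: sum.union_disjoint)
    thus ?thesis using s by simp
  qed
  hence QL: "L / 2 \<le> (\<Sum>p\<in>Q. ln (real p) / (real p powr s - 1))" using small by linarith
  have gen: "(\<Sum>p\<in>A. ln (real p) / (real p powr s - 1)) \<le> 7/2 * ln y * (\<Sum>p\<in>A. real p powr - s)"
    if "A \<subseteq> P" for A
    unfolding sum_distrib_left
  proof (rule sum_mono)
    fix p assume "p \<in> A"
    hence p: "p \<in> P" using that by auto
    have "ln (real p) * real p powr - s \<le> ln y * real p powr - s"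
      using pp[OF p] by (intro mult_right_mono) auto
    thus "ln (real p) / (real p powr s - 1) \<le> 7/2 * ln y * real p powr - s" using up[OF p] by linarith
  qed
  show thesis
  proof (rule that[OF s2 s1])
    show "log_mean (primes_le y) s = (998/1000) * l" using s by (simp add: P_def L_def)
    have "L / 2 \<le> 7/2 * ln y * (\<Sum>p\<in>Q. real p powr - s)" using QL gen[of Q] by (force simp: Q_def)
    hence "499 / 1000 * l \<le> 7/2 * (ln y * (\<Sum>p\<in>Q. real p powr - s))" by (simp add: L_def)
    hence "l \<le> 8 * (ln y * (\<Sum>p\<in>Q. real p powr - s))" using l0 by linarith
    hence "l \<le> 8 * (\<Sum>p\<in>Q. real p powr - s) * ln y" by (simp only: mult_ac)
    thus "l / ln y \<le> 8 * (\<Sum>p\<in>{p\<in>primes_le y. sqrt y < real p}. real p powr - s)"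
      using lny by (simp add: Q_def P_def R_def pos_divide_le_eq)
    have "L \<le> 7/2 * ln y * (\<Sum>p\<in>P. real p powr - s)" using gen[of P] s by (simp add: log_mean_def)
    hence "(2/7) * (998/1000) * l \<le> (\<Sum>p\<in>P. real p powr - s) * ln y" by (simp add: L_def mult_ac)
    thus "(2/7) * (998/1000) * (l / ln y) \<le> (\<Sum>p\<in>primes_le y. real p powr - s)"
      using lny by (simp add: P_def field_simps)
  qed
qed

section \<open>The mean value over characters\<close>

text \<open>Both \<open>q\<close> and \<open>x powr (3/2)\<close> are at least \<open>x\<close>, so the quotient of logarithms lies between \<open>1\<close> and
  \<open>3/2\<close> and the Gaussian exponent is at most \<open>u/16\<close> in absolute value.\<close>

lemma char_bound_ge:
  assumes "2 \<le> y" "y \<le> x" "x \<le> real q"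
  shows "(ln x) powr (3/2) * (ln y) powr (1/2) * exp (- (ln x / ln y) / 16) \<le> char_bound x y q"
proof -
  define r where "r = ln (min (real q) (x powr (3/2))) / ln x"
  have x: "1 < x" "0 < ln x" "0 < ln y" using assms by auto
  have "ln x \<le> ln (min (real q) (x powr (3/2)))"
    using x assms powr_mono[of 1 "3/2" x] by (subst ln_le_cancel_iff) auto
  hence r1: "1 \<le> r" using x by (simp add: r_def)
  have "ln (min (real q) (x powr (3/2))) \<le> ln (x powr (3/2))"
    using x assms by (subst ln_le_cancel_iff) auto
  also have "\<dots> = 3/2 * ln x" using x by (simp add: ln_powr)
  finally have r2: "r \<le> 3/2" using x by (simp add: r_def pos_divide_le_eq)
  have "(r - 1)\<^sup>2 \<le> (1/2)\<^sup>2" using r1 r2 by (intro power_mono) auto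
  hence "(ln x / ln y) / 4 * (r - 1)\<^sup>2 \<le> (ln x / ln y) / 4 * (1/2)\<^sup>2" using x by (intro mult_left_mono) auto
  also have "\<dots> = (ln x / ln y) / 16" by (simp add: power2_eq_square)
  finally have "exp (- (ln x / ln y) / 16) \<le> exp (- ((ln x / ln y) / 4) * (r - 1)\<^sup>2)" by simp
  also have "\<dots> \<le> y powr (1/2 - saddle_point x y) + exp (- ((ln x / ln y) / 4) * (r - 1)\<^sup>2)" by simp
  finally have "(ln x) powr (3/2) * (ln y) powr (1/2) * exp (- (ln x / ln y) / 16)
      \<le> (ln x) powr (3/2) * (ln y) powr (1/2) * (y powr (1/2 - saddle_point x y) + exp (- ((ln x / ln y) / 4) * (r - 1)\<^sup>2))"
    by (intro mult_left_mono) auto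
  also have "\<dots> = char_bound x y q" by (simp add: char_bound_def Let_def r_def)
  finally show ?thesis .
qed

lemma smooth_upto_eq:
  assumes "1 \<le> y" "0 \<le> x"
  shows "smooth_upto x y = {n\<in>smooth_over (primes_le y). real n \<le> x}"
    and "smooth_upto x y = smooth_over (primes_le y) \<inter> {1..nat \<lfloor>x\<rfloor>}"
proof -
  show *: "smooth_upto x y = {n\<in>smooth_over (primes_le y). real n \<le> x}"
    using smooth_upto_altdef[OF assms(1)] by (simp add: primes_le_def)
  have "real n \<le> x \<longleftrightarrow> n \<le> nat \<lfloor>x\<rfloor>" for n using assms(2) by (simp add: le_nat_iff le_floor_iff)
  thus "smooth_upto x y = smooth_over (primes_le y) \<inter> {1..nat \<lfloor>x\<rfloor>}"
    unfolding * by (auto simp: smooth_over_def)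
qed

definition mean_char_sum :: "(nat \<Rightarrow> complex) \<Rightarrow> nat \<Rightarrow> real \<Rightarrow> real \<Rightarrow> real" where
  "mean_char_sum h q x y = (1 / real (totient q)) *
      (\<Sum>\<chi>\<in>dirichlet_chars q. norm (\<Sum>n\<in>smooth_upto x y. h n * \<chi> n))"

text \<open>There are at most \<open>totient q\<close> characters and every term has absolute value at most one.\<close>

lemma mean_char_sum_trivial:
  assumes h: "completely_multiplicative h" and hp: "\<And>p. prime p \<Longrightarrow> norm (h p) \<le> 1" and q: "0 < q"
  shows "mean_char_sum h q x y \<le> real (smooth_count x y)"
proof -
  have "(\<Sum>\<chi>\<in>dirichlet_chars q. norm (\<Sum>n\<in>smooth_upto x y. h n * \<chi> n))
      \<le> (\<Sum>\<chi>\<in>dirichlet_chars q. real (smooth_count x y))"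
  proof (rule sum_mono)
    fix \<chi> assume \<chi>: "\<chi> \<in> dirichlet_chars q"
    have "norm (\<Sum>n\<in>smooth_upto x y. h n * \<chi> n) \<le> (\<Sum>n\<in>smooth_upto x y. 1)"
    proof (rule sum_norm_le)
      fix n assume "n \<in> smooth_upto x y"
      hence "norm (h n) \<le> 1"
        using norm_completely_multiplicative_le_1[OF h hp] by (simp add: smooth_upto_def)
      moreover have "norm (\<chi> n) \<le> 1" using norm_dirichlet_char_le_1[OF _ q] \<chi> by (simp add: dirichlet_chars_def)
      ultimately show "norm (h n * \<chi> n) \<le> 1" by (simp add: norm_mult mult_le_one)
    qed
    thus "norm (\<Sum>n\<in>smooth_upto x y. h n * \<chi> n) \<le> real (smooth_count x y)" by (simp add: smooth_count_def)
  qed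
  also have "\<dots> \<le> real (totient q) * real (smooth_count x y)"
    using card_dirichlet_chars_le[OF q] by (simp add: mult_right_mono)
  finally show ?thesis using q by (simp add: mean_char_sum_def pos_divide_le_eq mult.commute)
qed

lemma mean_char_sum_rankin:
  assumes h: "completely_multiplicative h" and hp: "\<And>p. prime p \<Longrightarrow> norm (h p) \<le> 1" and q: "0 < q"
    and y: "1 \<le> y" and x: "exp 1 \<le> x" "x \<le> real q" and s: "0 < s"
  shows "(mean_char_sum h q x y)\<^sup>2 \<le> 9 * (ln x)\<^sup>2 *
    (x powr s * (euler_product (primes_le y) s * exp (- (\<Sum>p\<in>primes_le y. real p powr - s) / 2)))"
proof -
  define N where "N = nat \<lfloor>x\<rfloor>"
  define P where "P = primes_le y"
  define Z where "Z = euler_product P s * exp (- (\<Sum>p\<in>P. real p powr - s) / 2)"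
  have lx: "1 \<le> ln x" using x by (metis exp_gt_zero ln_exp ln_le_cancel_iff order_less_le_trans)
  have x1: "1 \<le> x" using x exp_ge_add_one_self[of 1] by linarith
  have N: "1 \<le> N" "real N \<le> x" "N \<le> q" using x1 x by (auto simp: N_def le_nat_iff nat_le_iff floor_le_iff)
  obtain n where n: "2 ^ n \<le> N" "N < 2 ^ (n + 1)" using ex_power_ivl1[of 2 N] N by auto
  have "real (2 ^ n) \<le> x" using n(1) N(2) by linarith
  hence "(2 :: real) ^ n \<le> x" by simp
  hence "ln ((2 :: real) ^ n) \<le> ln x" using x1 by (subst ln_le_cancel_iff) auto
  hence "real n * ln 2 \<le> ln x" by (simp add: ln_realpow)
  moreover have "1/2 \<le> ln (2::real)" using exp_half_le2 by (subst ln_ge_iff) auto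
  hence "real n * (1/2) \<le> real n * ln 2" by (intro mult_left_mono) auto
  ultimately have k: "real (n + 1) \<le> 3 * ln x" using lx by simp
  define A where "A = (\<Sum>a\<in>smooth_over P \<inter> {1..2^(n+1)}. (1/4) ^ big_omega a * real a powr - s)"
  define B where "B = (\<Sum>b\<in>smooth_over P \<inter> {1..N}. (1/4) ^ small_omega b * real b powr - s)"
  have AB: "0 \<le> A" "0 \<le> B" by (auto simp: A_def B_def intro!: sum_nonneg)
  have ABZ: "A * B \<le> Z"
    unfolding A_def B_def Z_def
    by (rule square_root_weights_le) (use s in \<open>auto simp: P_def primes_le_def[of y]\<close>)
  have "mean_char_sum h q x y = (1 / real (totient q)) *
      (\<Sum>\<chi>\<in>dirichlet_chars q. norm (\<Sum>n\<in>smooth_over P \<inter> {1..N}. h n * \<chi> n))"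
    unfolding mean_char_sum_def P_def N_def using smooth_upto_eq(2)[OF y] x1 by simp
  also have "\<dots> \<le> (1 / real (totient q)) * (real (totient q) * (real N powr (s / 2) * real (n + 1) * sqrt (A * B)))"
    unfolding A_def B_def
    by (intro mult_left_mono mean_abs_smooth_char_sum_le[OF q N(3) h hp n(2)]) (use s in auto)
  also have "\<dots> = real N powr (s / 2) * real (n + 1) * sqrt (A * B)" using q by simp
  also have "\<dots> \<le> x powr (s / 2) * (3 * ln x) * sqrt Z"
    using N k s lx ABZ AB by (intro mult_mono powr_mono2) auto
  finally have "(mean_char_sum h q x y)\<^sup>2 \<le> (x powr (s / 2) * (3 * ln x) * sqrt Z)\<^sup>2"
    by (rule power_mono) (auto simp: mean_char_sum_def intro!: divide_nonneg_nonneg sum_nonneg)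
  also have "\<dots> = 9 * (ln x)\<^sup>2 * (x powr s * Z)"
  proof -
    have "0 \<le> Z" using ABZ AB by (meson mult_nonneg_nonneg order_trans)
    moreover have "(x powr (s / 2))\<^sup>2 = x powr s" by (simp add: power2_eq_square flip: powr_add)
    ultimately show ?thesis by (simp add: power_mult_distrib mult_ac)
  qed
  finally show ?thesis by (simp add: Z_def P_def)
qed

text \<open>The measure with mean \<open>0.998 ln x\<close> keeps half of its mass above \<open>0.997 ln x\<close>, at most
  \<open>6/1000 * u + 1\<close> steps of size \<open>ln r = ln y / 2\<close> below \<open>ln x\<close>.  Each step costs a factor
  \<open>17 \<le> exp 4\<close>.\<close>

lemma euler_product_le_smooth_count:
  assumes y: "2 \<le> y" and x1: "1 < x" and x: "1 \<le> ln x" and u: "10 ^ 8 * ln y \<le> ln x" and s: "1/2 \<le> s" "s \<le> 1"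
    and mean: "log_mean (primes_le y) s = (998/1000) * ln x"
    and W: "ln x / ln y \<le> 8 * (\<Sum>p\<in>{p\<in>primes_le y. sqrt y < real p}. real p powr - s)"
  shows "x powr s * euler_product (primes_le y) s
    \<le> 4 * exp 13 * ln x * exp (24/1000 * (ln x / ln y)) * real (smooth_count x y)"
proof -
  define P where "P = primes_le y"
  define u where "u = ln x / ln y"
  define r where "r = sqrt y"
  define e :: real where "e = 1/1000"
  define K where "K = nat \<lceil>6/1000 * u\<rceil>"
  have x0: "0 < x" using x1 by simp
  have lny: "0 < ln y" "1 < y" using y by auto
  have r: "1 < r" "r\<^sup>2 = y" "ln r = ln y / 2" using y by (auto simp: r_def ln_sqrt)
  have u8: "100000000 \<le> u" using u lny by (simp add: u_def pos_le_divide_eq)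
  have PP: "finite P" "\<And>p. p \<in> P \<Longrightarrow> prime p \<and> real p \<le> y" by (auto simp: P_def primes_le_def[of y])
  have K: "6/1000 * u \<le> real K" "real K \<le> 6/1000 * u + 1"
    using u8 by (auto simp: K_def intro: of_nat_ceiling)
  have Psi: "real (smooth_count x y) = real (card {n\<in>smooth_over P. real n \<le> x})"
    using smooth_upto_eq(1)[of y x] y x0 by (simp add: smooth_count_def P_def)
  have "euler_product P s \<le> 2 * (\<Sum>n\<in>{n\<in>smooth_over P. (1 - 3 * e) * ln x < ln (real n) \<and> ln (real n) \<le> ln x}. real n powr - s)"
  proof (rule rankin_measure_concentration[OF PP s(1) y])
    show "log_mean P s = (1 - 2 * e) * ln x" using mean by (simp add: P_def e_def)
    have "(1/16000::real) \<le> ln (1 + e / 8)"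
    proof -
      have "e / 8 - (e / 8)\<^sup>2 \<le> ln (1 + e / 8)" by (rule ln_one_plus_pos_lower_bound) (auto simp: e_def)
      thus ?thesis by (simp add: e_def power2_eq_square)
    qed
    hence "1/16000 * u * (e / 2) \<le> ln (1 + e / 8) * u * (e / 2)"
      using u8 by (intro mult_right_mono) (auto simp: e_def)
    moreover have "3 \<le> 1/16000 * u * (e / 2)" using u8 by (simp add: e_def)
    moreover have "ln (4::real) \<le> 3" using ln_le_minus_one[of 4] by simp
    ultimately show "ln 4 \<le> ln (1 + e / 8) * (ln x / ln y) * (e / 2)"
      unfolding u_def[symmetric] by linarith
  qed (use x in \<open>auto simp: e_def\<close>)
  also have "(\<Sum>n\<in>{n\<in>smooth_over P. (1 - 3 * e) * ln x < ln (real n) \<and> ln (real n) \<le> ln x}. real n powr - s)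
      \<le> mass P s (x / r ^ K) x"
    unfolding mass_def
  proof (rule sum_mono2)
    show "{n\<in>smooth_over P. (1 - 3 * e) * ln x < ln (real n) \<and> ln (real n) \<le> ln x}
        \<subseteq> {n \<in> smooth_over P. x / r ^ K < real n \<and> real n \<le> x}"
    proof safe
      fix n assume n: "n \<in> smooth_over P" "(1 - 3 * e) * ln x < ln (real n)" "ln (real n) \<le> ln x"
      have n0: "0 < real n" using n by (simp add: smooth_over_def)
      show "real n \<le> x" using n n0 x0 by simp
      have "6/1000 * u * ln y \<le> real K * ln y" using K lny by (intro mult_right_mono) auto
      moreover have "u * ln y = ln x" using lny by (simp add: u_def)
      ultimately have "3/1000 * ln x \<le> real K * ln r" unfolding r(3) by simp
      moreover have "ln (x / r ^ K) = ln x - real K * ln r" using x0 r by (simp add: ln_div ln_realpow)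
      ultimately have "ln (x / r ^ K) < ln (real n)" using n by (simp add: e_def)
      thus "x / r ^ K < real n" using n0 x0 r by (subst (asm) ln_less_cancel_iff) auto
    qed
  qed auto
  also have "mass P s (x / r ^ K) x \<le> 17 ^ K * mass P s (x / r\<^sup>2) x"
  proof (rule mass_top_window[OF PP(1) _ r(1) x1])
    show "ln x / ln r \<le> 16 * (\<Sum>p\<in>{p\<in>P. r < real p}. real p powr - s)"
    proof -
      have "ln x / ln r = 2 * (ln x / ln y)" by (simp add: r(3))
      thus ?thesis using W unfolding P_def r_def by linarith
    qed
  qed (use PP r in auto)
  finally have "x powr s * euler_product P s \<le> x powr s * (2 * (17 ^ K * mass P s (x / y) x))"
    using r by (intro mult_left_mono) auto
  also have "\<dots> = 2 * 17 ^ K * (x powr s * mass P s (x / y) x)" by simp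
  also have "\<dots> \<le> 2 * 17 ^ K * (exp 9 * (ln x + 1) * real (smooth_count x y))"
    unfolding Psi unfolding P_def using lny x1 s by (intro mult_left_mono smooth_count_ge_mass) auto
  also have "\<dots> \<le> 2 * (exp 4 * exp (24/1000 * u)) * (exp 9 * (2 * ln x) * real (smooth_count x y))"
  proof (intro mult_mono)
    have "17 \<le> exp (4::real)"
    proof -
      have "5 \<le> exp (2::real)" using exp_lower_Taylor_quadratic[of 2] by simp
      hence "5 * 5 \<le> exp 2 * exp (2::real)" by (intro mult_mono) auto
      also have "exp 2 * exp (2::real) = exp 4" by (simp flip: exp_add)
      finally show ?thesis by simp
    qed
    hence "17 ^ K \<le> exp (4::real) ^ K" by (intro power_mono) auto
    also have "\<dots> = exp (4 * real K)" by (simp add: exp_of_nat_mult[symmetric] mult.commute)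
    also have "\<dots> \<le> exp (4 + 24/1000 * u)" using K by simp
    finally show "17 ^ K \<le> exp 4 * exp (24/1000 * u)" by (simp add: exp_add)
  qed (use x in auto)
  also have "\<dots> = 4 * exp 13 * ln x * exp (24/1000 * u) * real (smooth_count x y)"
  proof -
    have "exp (13::real) = exp 4 * exp 9" by (simp flip: exp_add)
    thus ?thesis by simp
  qed
  finally show ?thesis by (simp add: P_def u_def)
qed

text \<open>For the square of the mean the saving is \<open>exp (- 0.142 u)\<close>, of which the comparison with the smooth count uses
  \<open>exp (0.024 u)\<close> and the target \<open>exp (- u / 16)\<close>; the rest pays for the factor \<open>l powr (3/2)\<close> in excess of
  \<open>char_bound\<close>, as \<open>ln l \<le> u / 32\<close>.  The threshold for \<open>x\<close> makes \<open>u \<ge> 10 ^ 8\<close>, as the concentration step requires.\<close>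

lemma mean_char_sum_large:
  assumes h: "completely_multiplicative h" and hp: "\<And>p. prime p \<Longrightarrow> norm (h p) \<le> 1" and q: "0 < q"
    and y: "2 \<le> y" "y \<le> x" and xq: "x \<le> real q"
    and large: "exp (10 ^ 7) \<le> ln x" and ly: "(ln x) ^ 6 \<le> y" and yx: "y \<le> x powr (1 / (32 * ln (ln x)))"
  shows "(mean_char_sum h q x y)\<^sup>2 \<le> 36 * exp 13 * (real (smooth_count x y) * char_bound x y q)"
proof -
  define l where "l = ln x"
  define u where "u = l / ln y"
  have l1: "1 \<le> l" using large exp_ge_add_one_self[of "10 ^ 7"] by (simp add: l_def)
  have ll: "10000000 \<le> ln l" using large l1 by (subst ln_ge_iff) (auto simp: l_def)
  have x1: "1 < x" using l1 y by simp
  have lny: "0 < ln y" using y by simp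
  have "ln (l ^ 6) \<le> ln y" using ly l1 y by (subst ln_le_cancel_iff) (auto simp: l_def)
  hence "6 * ln l \<le> ln y" using l1 by (simp add: ln_realpow)
  hence y64: "64 \<le> ln y" using ll by linarith
  have "ln y \<le> ln (x powr (1 / (32 * ln l)))" using yx y x1 by (subst ln_le_cancel_iff) (auto simp: l_def)
  also have "\<dots> = l / (32 * ln l)" using x1 by (simp add: ln_powr l_def)
  finally have "32 * ln l * ln y \<le> l" using ll by (simp add: field_simps)
  hence u32: "32 * ln l \<le> u" using lny by (simp add: u_def pos_le_divide_eq)
  have "100000000 \<le> u" using u32 ll by linarith
  hence u8: "10 ^ 8 * ln y \<le> l" using lny by (simp add: u_def pos_le_divide_eq)
  obtain s where s: "1/2 \<le> s" "s \<le> 1" "log_mean (primes_le y) s = (998/1000) * l"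
    "l / ln y \<le> 8 * (\<Sum>p\<in>{p\<in>primes_le y. sqrt y < real p}. real p powr - s)"
    "(2/7) * (998/1000) * (l / ln y) \<le> (\<Sum>p\<in>primes_le y. real p powr - s)"
    using saddle_exponent[OF y(1) y64 u8] ly by (auto simp: l_def)
  define \<Psi> where "\<Psi> = real (smooth_count x y)"
  define Ep where "Ep = euler_product (primes_le y) s"
  have main: "x powr s * Ep \<le> 4 * exp 13 * l * exp (24/1000 * u) * \<Psi>"
    unfolding \<Psi>_def l_def u_def Ep_def
    by (rule euler_product_le_smooth_count) (use y l1 u8 s x1 in \<open>auto simp: l_def\<close>)
  have "(mean_char_sum h q x y)\<^sup>2 \<le> 9 * l\<^sup>2 * (x powr s * (Ep * exp (- (\<Sum>p\<in>primes_le y. real p powr - s) / 2)))"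
    unfolding l_def Ep_def
    by (rule mean_char_sum_rankin[OF h hp q _ _ xq]) (use y l1 s x1 in \<open>auto simp: l_def ln_ge_iff\<close>)
  also have "\<dots> = 9 * l\<^sup>2 * (x powr s * Ep) * exp (- (\<Sum>p\<in>primes_le y. real p powr - s) / 2)" by simp
  also have "\<dots> \<le> 9 * l\<^sup>2 * (4 * exp 13 * l * exp (24/1000 * u) * \<Psi>) * exp (- (142/1000) * u)"
  proof (rule mult_mono[OF mult_left_mono[OF main]])
    have "142/1000 * u \<le> (\<Sum>p\<in>primes_le y. real p powr - s) / 2"
      using s(5) \<open>100000000 \<le> u\<close> unfolding u_def[symmetric] by simp
    thus "exp (- (\<Sum>p\<in>primes_le y. real p powr - s) / 2) \<le> exp (- (142/1000) * u)" by simp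
  qed (use l1 in \<open>auto simp: \<Psi>_def\<close>)
  also have "\<dots> = 36 * exp 13 * \<Psi> * (l powr (3/2) * (l powr (3/2) * exp (- (118/1000) * u)))"
  proof -
    have "l\<^sup>2 * l = l powr (3/2) * l powr (3/2)"
      using l1 by (simp add: power2_eq_square flip: powr_add) (simp add: power3_eq_cube flip: powr_numeral)
    moreover have "exp (24/1000 * u) * exp (- (142/1000) * u) = exp (- (118/1000) * u)"
      by (simp flip: exp_add)
    moreover have "9 * l\<^sup>2 * (4 * exp 13 * l * exp (24/1000 * u) * \<Psi>) * exp (- (142/1000) * u)
        = 36 * exp 13 * \<Psi> * ((l\<^sup>2 * l) * (exp (24/1000 * u) * exp (- (142/1000) * u)))"
      by (simp only: mult_ac)
    ultimately show ?thesis by (simp only: mult.assoc)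
  qed
  also have "\<dots> \<le> 36 * exp 13 * \<Psi> * char_bound x y q"
  proof (intro mult_left_mono)
    have "l powr (3/2) * exp (- (118/1000) * u) = exp (3/2 * ln l + - (118/1000) * u)"
      using l1 by (simp only: exp_add) (simp add: powr_def)
    also have "\<dots> \<le> exp (- u / 16)" using u32 ll by simp
    finally have "l powr (3/2) * (l powr (3/2) * exp (- (118/1000) * u)) \<le> l powr (3/2) * exp (- u / 16)"
      by (intro mult_left_mono) auto
    also have "\<dots> \<le> l powr (3/2) * (ln y) powr (1/2) * exp (- u / 16)"
    proof -
      have "1 \<le> (ln y) powr (1/2)" using y64 by (intro ge_one_powr_ge_zero) auto
      hence "l powr (3/2) * 1 * exp (- u / 16) \<le> l powr (3/2) * (ln y) powr (1/2) * exp (- u / 16)"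
        by (intro mult_right_mono mult_left_mono) auto
      thus ?thesis by simp
    qed
    also have "\<dots> \<le> char_bound x y q"
      using char_bound_ge[OF y xq] by (simp add: l_def u_def)
    finally show "l powr (3/2) * (l powr (3/2) * exp (- (118/1000) * u)) \<le> char_bound x y q" .
  qed (auto simp: \<Psi>_def)
  finally show ?thesis by (simp add: \<Psi>_def mult_ac)
qed

lemma mean_char_sum_small:
  assumes h: "completely_multiplicative h" and hp: "\<And>p. prime p \<Longrightarrow> norm (h p) \<le> 1" and q: "0 < q"
    and y: "2 \<le> y" "y \<le> x" and xq: "x \<le> real q" and small: "ln x \<le> M"
  shows "(mean_char_sum h q x y)\<^sup>2 \<le> exp M * exp (M / (16 * ln 2)) / (ln 2)\<^sup>2 * (real (smooth_count x y) * char_bound x y q)"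
proof -
  define \<Psi> where "\<Psi> = real (smooth_count x y)"
  define c where "c = (ln 2)\<^sup>2 * exp (- (M / (16 * ln 2)))"
  have c0: "0 < c" by (simp add: c_def)
  have x: "2 \<le> x" "0 < ln x" using y by auto
  have M0: "0 \<le> M" using x small by linarith
  have ly: "ln 2 \<le> ln y" "ln 2 \<le> ln x" using y by auto
  have "\<Psi> \<le> x"
  proof -
    have "smooth_upto x y \<subseteq> {1..nat \<lfloor>x\<rfloor>}" using smooth_upto_eq(2)[of y x] y by auto
    hence "smooth_count x y \<le> nat \<lfloor>x\<rfloor>"
      unfolding smooth_count_def using card_mono[of "{1..nat \<lfloor>x\<rfloor>}"] by fastforce
    thus ?thesis using x unfolding \<Psi>_def by linarith
  qed
  also have "x \<le> exp M" using small x by (metis exp_le_cancel_iff exp_ln less_le_trans zero_less_numeral)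
  finally have \<Psi>: "\<Psi> \<le> exp M" .
  have "c \<le> char_bound x y q"
  proof -
    have "(ln x / ln y) / 16 \<le> M / (16 * ln 2)"
    proof -
      have "ln x / ln y \<le> M / ln 2" using ly x small M0 by (intro frac_le) auto
      thus ?thesis by (simp add: field_simps)
    qed
    hence "exp (- (M / (16 * ln 2))) \<le> exp (- (ln x / ln y) / 16)" by simp
    moreover have "(ln 2 :: real)\<^sup>2 \<le> (ln x) powr (3/2) * (ln y) powr (1/2)"
    proof -
      have "(ln 2 :: real)\<^sup>2 = (ln 2) powr (3/2) * (ln 2) powr (1/2)"
      proof -
        have "(ln 2 :: real) powr (3/2) * (ln 2) powr (1/2) = (ln 2) powr 2" by (simp flip: powr_add)
        also have "\<dots> = (ln 2)\<^sup>2" by (rule powr_numeral) simp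
        finally show ?thesis by simp
      qed
      also have "\<dots> \<le> (ln x) powr (3/2) * (ln y) powr (1/2)"
        using ly by (intro mult_mono powr_mono2) auto
      finally show ?thesis .
    qed
    ultimately have "c \<le> (ln x) powr (3/2) * (ln y) powr (1/2) * exp (- (ln x / ln y) / 16)"
      unfolding c_def by (intro mult_mono) auto
    also have "\<dots> \<le> char_bound x y q" by (rule char_bound_ge[OF y xq])
    finally show ?thesis .
  qed
  have "0 \<le> mean_char_sum h q x y" by (auto simp: mean_char_sum_def intro!: divide_nonneg_nonneg sum_nonneg)
  hence "(mean_char_sum h q x y)\<^sup>2 \<le> \<Psi>\<^sup>2"
    unfolding \<Psi>_def by (intro power_mono mean_char_sum_trivial[OF h hp q])
  also have "\<dots> = \<Psi> * \<Psi>" by (simp add: power2_eq_square)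
  also have "\<dots> \<le> \<Psi> * exp M" using \<Psi> by (intro mult_left_mono) (auto simp: \<Psi>_def)
  also have "\<dots> = exp M / c * (\<Psi> * c)" using c0 by simp
  also have "\<dots> \<le> exp M / c * (\<Psi> * char_bound x y q)"
    using \<open>c \<le> char_bound x y q\<close> c0 by (intro mult_left_mono) (auto simp: \<Psi>_def)
  also have "exp M / c = exp M * exp (M / (16 * ln 2)) / (ln 2)\<^sup>2"
    by (simp add: c_def exp_minus field_simps)
  finally show ?thesis by (simp add: \<Psi>_def)
qed

theorem theorem2:
  shows "\<exists>C::real. 0 < C \<and> ( \<forall>(h :: nat \<Rightarrow> complex) (q :: nat) (x :: real) (y :: real).
    completely_multiplicative h \<longrightarrow>
    (\<forall>p. prime p \<longrightarrow> norm (h p) \<le> 1) \<longrightarrow>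
    0 < q \<longrightarrow>
    2 \<le> y \<longrightarrow> y \<le> x \<longrightarrow> 2 \<le> x \<longrightarrow> x \<le> real q \<longrightarrow>
    (ln x) ^ 6 \<le> y \<longrightarrow> y \<le> x powr (1 / (32 * ln (ln x))) \<longrightarrow>
    (1 / real (totient q)) *
      (\<Sum>\<chi>\<in>dirichlet_chars q. norm (\<Sum>n\<in>smooth_upto x y. h n * \<chi> n))
    \<le> C * sqrt (real (smooth_count x y) * char_bound x y q))"
proof -
  define M :: real where "M = exp (10 ^ 7)"
  define D :: real where "D = 36 * exp 13 + exp M * exp (M / (16 * ln 2)) / (ln 2)\<^sup>2"
  have D: "0 < D" "36 * exp 13 \<le> D" "exp M * exp (M / (16 * ln 2)) / (ln 2)\<^sup>2 \<le> D"
    by (auto simp: D_def add_pos_nonneg)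
  have "mean_char_sum h q x y \<le> sqrt D * sqrt (real (smooth_count x y) * char_bound x y q)"
    if h: "completely_multiplicative h" "\<forall>p. prime p \<longrightarrow> norm (h p) \<le> 1" "0 < q"
      and y: "2 \<le> y" "y \<le> x" and xq: "x \<le> real q"
      and r: "(ln x) ^ 6 \<le> y" "y \<le> x powr (1 / (32 * ln (ln x)))" for h q x y
  proof -
    define T where "T = real (smooth_count x y) * char_bound x y q"
    have "0 \<le> char_bound x y q" by (rule order_trans[OF _ char_bound_ge[OF y xq]]) simp
    hence T: "0 \<le> T" by (simp add: T_def)
    have "(mean_char_sum h q x y)\<^sup>2 \<le> D * T"
    proof (cases "M \<le> ln x")
      case True
      have "(mean_char_sum h q x y)\<^sup>2 \<le> 36 * exp 13 * T"
        unfolding T_def by (rule mean_char_sum_large) (use that True in \<open>auto simp: M_def\<close>)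
      thus ?thesis using mult_right_mono[OF D(2) T] by linarith
    next
      case False
      have "(mean_char_sum h q x y)\<^sup>2 \<le> exp M * exp (M / (16 * ln 2)) / (ln 2)\<^sup>2 * T"
        unfolding T_def by (rule mean_char_sum_small) (use that False in auto)
      thus ?thesis using mult_right_mono[OF D(3) T] by linarith
    qed
    hence "mean_char_sum h q x y \<le> sqrt (D * T)" by (rule real_le_rsqrt)
    thus ?thesis by (simp add: real_sqrt_mult T_def)
  qed
  hence "0 < sqrt D \<and> (\<forall>h q x y. completely_multiplicative h \<longrightarrow> (\<forall>p. prime p \<longrightarrow> norm (h p) \<le> 1) \<longrightarrow>
    0 < q \<longrightarrow> 2 \<le> y \<longrightarrow> y \<le> x \<longrightarrow> 2 \<le> x \<longrightarrow> x \<le> real q \<longrightarrow>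
    (ln x) ^ 6 \<le> y \<longrightarrow> y \<le> x powr (1 / (32 * ln (ln x))) \<longrightarrow>
    mean_char_sum h q x y \<le> sqrt D * sqrt (real (smooth_count x y) * char_bound x y q))"
    using D(1) by simp
  thus ?thesis unfolding mean_char_sum_def by blast
qed

end
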